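(* Let $n$ be a positive integer. The ring homomorphism $$\varphi:\ \mathbb{Z}[U]=\mathbb{Z}[z_{ij}\mid 1\le j<i\le n]\ \longrightarrow\ Q_n=\mathbb{Z}[x_1,\ldots,x_n,q_{ij}\mid 1\le i<j\le n]/(E_1^{(n)},\ldots,E_n^{(n)}),\qquad z_{ij}\mapsto H_{i-j}^{(j)}$$ is an isomorphism of graded rings.
   Context: Fix a positive integer $n$. Let $R_n=\mathbb{Z}[x_1,\ldots,x_n,q_{ij}\mid 1\le i<j\le n]$, graded by $\deg x_i=2$, $\deg q_{ij}=2(j-i+1)$. For $0\le j\le n$ let $M_j$ be the $j\times j$ matrix with diagonal entries $x_1,\ldots,x_j$, with $(a,b)$ entry $q_{ab}$ for $a<b$, with entries $-1$ in positions $(a+1,a)$, and $0$ elsewhere. Define $E_i^{(j)}\in R_n$ by $\det(tI_j-M_j)=\sum_{i=0}^{j}(-1)^iE_i^{(j)}t^{j-i}$, with $E_0^{(j)}=1$ and $E_i^{(j)}=0$ unless $0\le i\le j$. $\mathbf{q}$-quantization: let $e_i^{(j)}=e_i(x_1,\ldots,x_j)$ be the elementary symmetric polynomial ($e_0^{(j)}=1$, $e_i^{(j)}=0$ unless $0\le i\le j$). The standard elementary monomials $e_{i_1,\ldots,i_m}=e_{i_1}^{(1)}\cdots e_{i_m}^{(m)}$ ($0\le i_k\le k$; sequences differing by trailing zeros are identified) form a $\mathbb{Z}$-basis of $\mathbb{Z}[x_1,x_2,\ldots]$. If $f=\sum c_{i_1,\ldots,i_m}e_{i_1,\ldots,i_m}$,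 its $\mathbf{q}$-quantization is $F=\sum c_{i_1,\ldots,i_m}E_{i_1}^{(1)}\cdots E_{i_m}^{(m)}$ (it lies in $R_n$ when only indices $m\le n$ occur, which is the case here). $H_i^{(j)}$ denotes the $\mathbf{q}$-quantization of the complete symmetric polynomial $h_i^{(j)}=h_i(x_1,\ldots,x_j)$ (with $h_0^{(j)}=1$). An element of $R_n$ and its image in $Q_n=R_n/(E_1^{(n)},\ldots,E_n^{(n)})$ are denoted by the same symbol. $\mathbb{Z}[U]$ is the polynomial ring in the variables $z_{ij}$, $1\le j<i\le n$, graded by $\deg z_{ij}=2(i-j)$. *)

theory Defs
  imports
    "Jordan_Normal_Form.Char_Poly"
    "HOL-Library.Poly_Mapping"
    "HOL-Algebra.QuotRing"
begin

section \<open>Integer polynomials in variables from a set\<close>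

type_synonym 'v ipoly = "('v \<Rightarrow>\<^sub>0 nat) \<Rightarrow>\<^sub>0 int"

text \<open>A monomial is a finitely supported exponent function, and a polynomial is a finitely
  supported function from monomials to coefficients. The multiplication of \<^typ>\<open>'v ipoly\<close> is
  the convolution product of \<^theory>\<open>HOL-Library.Poly_Mapping\<close>, i.e. polynomial multiplication.\<close>

definition var :: "'v \<Rightarrow> 'v ipoly" where
  "var v = Poly_Mapping.single (Poly_Mapping.single v 1) 1"

definition poly_over :: "'v set \<Rightarrow> 'v ipoly ring" where
  "poly_over V = \<lparr>carrier = {p. \<forall>m \<in> Poly_Mapping.keys p. Poly_Mapping.keys m \<subseteq> V},
     mult = (*), one = 1, zero = 0, add = (+)\<rparr>"

definition weighted_deg :: "('v \<Rightarrow> nat) \<Rightarrow> ('v \<Rightarrow>\<^sub>0 nat) \<Rightarrow> nat" where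
  "weighted_deg w m = (\<Sum>v \<in> Poly_Mapping.keys m. w v * Poly_Mapping.lookup m v)"

definition homogeneous_part :: "'v set \<Rightarrow> ('v \<Rightarrow> nat) \<Rightarrow> nat \<Rightarrow> 'v ipoly set" where
  "homogeneous_part V w d =
     {p \<in> carrier (poly_over V). \<forall>m \<in> Poly_Mapping.keys p. weighted_deg w m = d}"

definition substitute :: "('v \<Rightarrow> 'w ipoly) \<Rightarrow> 'v ipoly \<Rightarrow> 'w ipoly" where
  "substitute f p =
     (\<Sum>m \<in> Poly_Mapping.keys p.
        of_int (Poly_Mapping.lookup p m) * (\<Prod>v \<in> Poly_Mapping.keys m. f v ^ Poly_Mapping.lookup m v))"


section \<open>Graded rings\<close>

locale graded_ring = ring R for R (structure) +
  fixes A :: "nat \<Rightarrow> 'a set"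
  assumes component_subgroup: "additive_subgroup (A d) R"
    and component_mult: "\<lbrakk>x \<in> A d; y \<in> A e\<rbrakk> \<Longrightarrow> x \<otimes> y \<in> A (d + e)"
    and direct_sum: "x \<in> carrier R \<Longrightarrow>
      \<exists>!f. (\<forall>d. f d \<in> A d) \<and> finite {d. f d \<noteq> \<zero>} \<and> x = (\<Oplus>d \<in> {d. f d \<noteq> \<zero>}. f d)"

definition graded_ring_iso ::
  "('a, 'm) ring_scheme \<Rightarrow> (nat \<Rightarrow> 'a set) \<Rightarrow> ('b, 'k) ring_scheme \<Rightarrow> (nat \<Rightarrow> 'b set)
    \<Rightarrow> ('a \<Rightarrow> 'b) \<Rightarrow> bool" where
  "graded_ring_iso R A S B f \<longleftrightarrow>
     graded_ring R A \<and> graded_ring S B \<and> f \<in> ring_iso R S \<and> (\<forall>d. f ` A d = B d)"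


section \<open>The polynomials $E_i^{(j)}$\<close>

text \<open>All variables $x_i$ and $q_{ij}$ live in one type; \<open>XQ_vars n\<close> selects those of $R_n$.
  The polynomials $E_i^{(j)}$ do not depend on $n$.\<close>

datatype xq = X nat | Q nat nat

definition XQ_vars :: "nat \<Rightarrow> xq set" where
  "XQ_vars n = {X i | i. 1 \<le> i \<and> i \<le> n} \<union> {Q i j | i j. 1 \<le> i \<and> i < j \<and> j \<le> n}"

fun xq_deg :: "xq \<Rightarrow> nat" where
  "xq_deg (X i) = 2"
| "xq_deg (Q i j) = 2 * (j - i + 1)"

definition R_ring :: "nat \<Rightarrow> xq ipoly ring" where
  "R_ring n = poly_over (XQ_vars n)"

text \<open>Rows and columns of \<^typ>\<open>'a mat\<close> are indexed from 0, hence the shift by one.\<close>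

definition M_mat :: "nat \<Rightarrow> xq ipoly mat" where
  "M_mat j = mat j j (\<lambda>(a, b).
     if a = b then var (X (a + 1))
     else if a < b then var (Q (a + 1) (b + 1))
     else if a = b + 1 then - 1
     else 0)"

text \<open>\<^term>\<open>char_poly M\<close> is $\det(tI - M)$, whose coefficient at $t^{j-i}$ is $(-1)^i E_i^{(j)}$.\<close>

definition E_poly :: "nat \<Rightarrow> nat \<Rightarrow> xq ipoly" where
  "E_poly i j = (if i \<le> j then (- 1) ^ i * poly.coeff (char_poly (M_mat j)) (j - i) else 0)"


section \<open>Quantization\<close>

definition e_poly :: "nat \<Rightarrow> nat \<Rightarrow> xq ipoly" where
  "e_poly i j = (\<Sum>S | S \<subseteq> {1..j} \<and> card S = i. \<Prod>k \<in> S. var (X k))"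

definition h_poly :: "nat \<Rightarrow> nat \<Rightarrow> xq ipoly" where
  "h_poly i j =
     (\<Sum>m | Poly_Mapping.keys m \<subseteq> X ` {1..j} \<and>
        (\<Sum>v \<in> Poly_Mapping.keys m. Poly_Mapping.lookup m v) = i.
        Poly_Mapping.single m 1)"

text \<open>A finite sequence $(i_1, \ldots, i_m)$ with $0 \le i_k \le k$, up to trailing zeros, is the
  finitely supported function \<open>k \<mapsto> i\<^sub>k\<close>; the inequality at $k = 0$ forces the unused entry $i_0$
  to be $0$. Since $e_0^{(k)} = E_0^{(k)} = 1$, products over the support suffice.\<close>

definition std_seqs :: "(nat \<Rightarrow>\<^sub>0 nat) set" where
  "std_seqs = {I. \<forall>k. Poly_Mapping.lookup I k \<le> k}"

definition e_monomial :: "(nat \<Rightarrow>\<^sub>0 nat) \<Rightarrow> xq ipoly" where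
  "e_monomial I = (\<Prod>k \<in> Poly_Mapping.keys I. e_poly (Poly_Mapping.lookup I k) k)"

definition E_monomial :: "(nat \<Rightarrow>\<^sub>0 nat) \<Rightarrow> xq ipoly" where
  "E_monomial I = (\<Prod>k \<in> Poly_Mapping.keys I. E_poly (Poly_Mapping.lookup I k) k)"

text \<open>The coefficients are well defined for every polynomial in the variables $x_k$ alone, as the
  standard elementary monomials form a $\mathbb{Z}$-basis of $\mathbb{Z}[x_1, x_2, \ldots]$.\<close>

definition e_coeffs :: "xq ipoly \<Rightarrow> (nat \<Rightarrow>\<^sub>0 nat) \<Rightarrow>\<^sub>0 int" where
  "e_coeffs f = (THE c. Poly_Mapping.keys c \<subseteq> std_seqs \<and>
     f = (\<Sum>I \<in> Poly_Mapping.keys c. of_int (Poly_Mapping.lookup c I) * e_monomial I))"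

definition quantization :: "xq ipoly \<Rightarrow> xq ipoly" where
  "quantization f =
     (\<Sum>I \<in> Poly_Mapping.keys (e_coeffs f).
        of_int (Poly_Mapping.lookup (e_coeffs f) I) * E_monomial I)"

definition H_poly :: "nat \<Rightarrow> nat \<Rightarrow> xq ipoly" where
  "H_poly i j = quantization (h_poly i j)"


section \<open>The rings $Q_n$ and $\mathbb{Z}[U]$ and the homomorphism between them\<close>

definition E_ideal :: "nat \<Rightarrow> xq ipoly set" where
  "E_ideal n = genideal (R_ring n) {E_poly i n | i. 1 \<le> i \<and> i \<le> n}"

definition Q_ring :: "nat \<Rightarrow> xq ipoly set ring" where
  "Q_ring n = R_ring n Quot E_ideal n"

definition to_Q :: "nat \<Rightarrow> xq ipoly \<Rightarrow> xq ipoly set" where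
  "to_Q n p = E_ideal n +>\<^bsub>R_ring n\<^esub> p"

definition Q_grading :: "nat \<Rightarrow> nat \<Rightarrow> xq ipoly set set" where
  "Q_grading n d = to_Q n ` homogeneous_part (XQ_vars n) xq_deg d"

text \<open>The pair \<open>(i, j)\<close> stands for the variable $z_{ij}$.\<close>

definition Z_vars :: "nat \<Rightarrow> (nat \<times> nat) set" where
  "Z_vars n = {(i, j). 1 \<le> j \<and> j < i \<and> i \<le> n}"

definition ZU_ring :: "nat \<Rightarrow> (nat \<times> nat) ipoly ring" where
  "ZU_ring n = poly_over (Z_vars n)"

definition ZU_grading :: "nat \<Rightarrow> nat \<Rightarrow> (nat \<times> nat) ipoly set" where
  "ZU_grading n = homogeneous_part (Z_vars n) (\<lambda>(i, j). 2 * (i - j))"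

definition phi :: "nat \<Rightarrow> (nat \<times> nat) ipoly \<Rightarrow> xq ipoly set" where
  "phi n p = to_Q n (substitute (\<lambda>(i, j). H_poly (i - j) j) p)"

end

theory Submission
  imports Defs "HOL-Computational_Algebra.Formal_Power_Series" "HOL-Combinatorics.Transposition"
begin

text \<open>The characteristic polynomials \<open>P_j\<close> of the matrices \<open>M_j\<close> satisfy a recurrence
  \<open>P_{j+1} = t P_j - (\<Sum>a\<le>j. y_a P_a)\<close>, where the \<open>y_a\<close> are the variables of column \<open>j + 1\<close> up to
  sign. As the \<open>P_a\<close> are monic of degree \<open>a\<close>, these variables can be recovered from the coefficients
  of the \<open>P_a\<close>, which may be prescribed arbitrarily: \<open>R_n\<close> is the polynomial ring in the
  \<open>E_i^{(j)}\<close> with \<open>1 \<le> i \<le> j \<le> n\<close>, and \<open>Q_n\<close> the one in those with \<open>j < n\<close>. Quantizing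
  \<open>(\<Sum>k\<le>i. (-1)^k e_k^{(j+i-1)} h_{i-k}^{(j)}) = 0\<close>, in which only standard elementary monomials
  appear, shows that the unitriangular matrices \<open>H_{i-j}^{(j)}\<close> and \<open>(-1)^{i-j} E_{i-j}^{(i-1)}\<close> are
  inverse to each other, so the \<open>H_{i-j}^{(j)}\<close> are polynomial generators of \<open>Q_n\<close> as well.\<close>

section \<open>Linear extension and evaluation\<close>

text \<open>Quantization is defined through a definite description of coefficients, so no H_i^{(j)}
  can be handled before expansions in standard elementary monomials are known to be unique.
  Uniqueness is proved at integer points: permuting their coordinates yields enough relations to
  separate the levels of a monomial one after another. An expansion of h_i^{(j)} is then exhibited
  together with its quantization, both read off the same recurrence.

  Bijectivity is treated asymmetrically. For injectivity, the freedom to prescribe the coefficients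
  of the P_j is used once: a single substitution sends P_n to t^n, hence kills the ideal, and sends
  H_{i-j}^{(j)} to z_{ij}, thereby undoing the map on representatives. For surjectivity, the
  recurrences are solved backwards, from the H to the E and from these to the variables, with
  degrees tracked on the way. The images of the graded pieces are thus known exactly, and the
  grading of Q_n is transported from Z[U].\<close>

definition linear_ext :: "('k \<Rightarrow> 'a::comm_ring_1) \<Rightarrow> ('k \<Rightarrow>\<^sub>0 int) \<Rightarrow> 'a" where
  "linear_ext B c = (\<Sum>m \<in> Poly_Mapping.keys c. of_int (Poly_Mapping.lookup c m) * B m)"

lemma linear_ext_superset:
  assumes "finite A" "Poly_Mapping.keys c \<subseteq> A"
  shows "linear_ext B c = (\<Sum>m\<in>A. of_int (Poly_Mapping.lookup c m) * B m)"
  unfolding linear_ext_def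
  by (rule sum.mono_neutral_left) (use assms in \<open>auto simp: in_keys_iff\<close>)

lemma linear_ext_zero [simp]: "linear_ext B 0 = 0"
  by (simp add: linear_ext_def)

lemma linear_ext_frag_of [simp]: "linear_ext B (frag_of k) = B k"
  by (simp add: linear_ext_def keys_frag_of)

lemma linear_ext_add: "linear_ext B (c + d) = linear_ext B c + linear_ext B d"
proof -
  let ?A = "Poly_Mapping.keys c \<union> Poly_Mapping.keys d"
  have "linear_ext B (c + d) = (\<Sum>m\<in>?A. of_int (Poly_Mapping.lookup (c + d) m) * B m)"
    by (rule linear_ext_superset) (use keys_add[of c d] in auto)
  moreover have "linear_ext B c = (\<Sum>m\<in>?A. of_int (Poly_Mapping.lookup c m) * B m)"
    by (rule linear_ext_superset) auto
  moreover have "linear_ext B d = (\<Sum>m\<in>?A. of_int (Poly_Mapping.lookup d m) * B m)"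
    by (rule linear_ext_superset) auto
  ultimately show ?thesis
    by (simp add: lookup_add algebra_simps sum.distrib)
qed

lemma linear_ext_uminus: "linear_ext B (- c) = - linear_ext B c"
  using linear_ext_add[of B c "- c"] by (simp add: eq_neg_iff_add_eq_0 add.commute)

lemma linear_ext_diff: "linear_ext B (c - d) = linear_ext B c - linear_ext B d"
  using linear_ext_add[of B c "- d"] by (simp add: linear_ext_uminus)

lemma linear_ext_cong:
  "(\<And>m. m \<in> Poly_Mapping.keys c \<Longrightarrow> B m = B' m) \<Longrightarrow> linear_ext B c = linear_ext B' c"
  unfolding linear_ext_def by (auto intro: sum.cong)

definition monom_eval :: "('v \<Rightarrow> 'a::comm_ring_1) \<Rightarrow> ('v \<Rightarrow>\<^sub>0 nat) \<Rightarrow> 'a" where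
  "monom_eval f m = (\<Prod>v \<in> Poly_Mapping.keys m. f v ^ Poly_Mapping.lookup m v)"

lemma monom_eval_superset:
  assumes "finite A" "Poly_Mapping.keys m \<subseteq> A"
  shows "monom_eval f m = (\<Prod>v\<in>A. f v ^ Poly_Mapping.lookup m v)"
  unfolding monom_eval_def
  by (rule prod.mono_neutral_left) (use assms in \<open>auto simp: in_keys_iff\<close>)

lemma monom_eval_add: "monom_eval f (m + m') = monom_eval f m * monom_eval f m'"
proof -
  let ?A = "Poly_Mapping.keys m \<union> Poly_Mapping.keys m'"
  have "monom_eval f (m + m') = (\<Prod>v\<in>?A. f v ^ Poly_Mapping.lookup (m + m') v)"
    by (rule monom_eval_superset) (use keys_add[of m m'] in auto)
  moreover have "monom_eval f m = (\<Prod>v\<in>?A. f v ^ Poly_Mapping.lookup m v)"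
    by (rule monom_eval_superset) auto
  moreover have "monom_eval f m' = (\<Prod>v\<in>?A. f v ^ Poly_Mapping.lookup m' v)"
    by (rule monom_eval_superset) auto
  ultimately show ?thesis
    by (simp add: lookup_add power_add prod.distrib)
qed

lemma monom_eval_zero [simp]: "monom_eval f 0 = 1"
  by (simp add: monom_eval_def)

text \<open>Unlike in \<open>substitute\<close>, the target is any commutative ring: the
  independence proof evaluates at integers, the other arguments at polynomials. Building it on
  \<open>linear_ext\<close> shares the additive laws with the expansions in
  \<open>e_monomial\<close> and \<open>E_monomial\<close>.\<close>

definition ipoly_eval :: "('v \<Rightarrow> 'a::comm_ring_1) \<Rightarrow> 'v ipoly \<Rightarrow> 'a" where
  "ipoly_eval f = linear_ext (monom_eval f)"

lemma substitute_eq_ipoly_eval: "substitute = ipoly_eval"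
  by (intro ext) (simp add: substitute_def ipoly_eval_def linear_ext_def monom_eval_def)

lemma ipoly_eval_add: "ipoly_eval f (p + q) = ipoly_eval f p + ipoly_eval f q"
  and ipoly_eval_diff: "ipoly_eval f (p - q) = ipoly_eval f p - ipoly_eval f q"
  and ipoly_eval_uminus: "ipoly_eval f (- p) = - ipoly_eval f p"
  and ipoly_eval_zero [simp]: "ipoly_eval f 0 = 0"
  by (simp_all add: ipoly_eval_def linear_ext_add linear_ext_diff linear_ext_uminus)

lemma ipoly_eval_frag_of: "ipoly_eval f (frag_of m) = monom_eval f m"
  by (simp add: ipoly_eval_def)

lemma ipoly_eval_one [simp]: "ipoly_eval f 1 = 1"
  using ipoly_eval_frag_of[of f 0] by simp

lemma ipoly_eval_var [simp]: "ipoly_eval f (var v) = f v"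
  by (simp add: var_def ipoly_eval_def linear_ext_def monom_eval_def)

lemma frag_of_mult: "frag_of m * frag_of m' = (frag_of (m + m') :: 'v ipoly)"
  by (simp add: mult_single)

lemma ipoly_eval_mult: "ipoly_eval f (p * q) = ipoly_eval f p * ipoly_eval f q"
proof (rule frag_induction[of p UNIV])
  fix m
  show "ipoly_eval f (frag_of m * q) = ipoly_eval f (frag_of m) * ipoly_eval f q"
    by (rule frag_induction[of q UNIV])
      (auto simp: frag_of_mult ipoly_eval_frag_of monom_eval_add right_diff_distrib ipoly_eval_diff)
qed (auto simp: left_diff_distrib ipoly_eval_diff)

interpretation ipoly_eval: comm_ring_hom "ipoly_eval f"
  by unfold_locales (auto simp: ipoly_eval_add ipoly_eval_mult)

text \<open>Together with \<open>frag_induction\<close> this reduces claims about a whole polynomial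
  ring to its variables, which is how surjectivity is reached later.\<close>

lemma frag_of_eq_prod_var: "frag_of m = monom_eval var m"
proof -
  have 1: "var v ^ k = frag_of (Poly_Mapping.single v k)" for v :: 'a and k
    by (induction k)
      (simp_all add: var_def mult_single single_add[symmetric])
  have 2: "(\<Prod>v\<in>A. frag_of (h v)) = (frag_of (\<Sum>v\<in>A. h v) :: 'a ipoly)" for A and h :: "'a \<Rightarrow> ('a \<Rightarrow>\<^sub>0 nat)"
    by (induction A rule: infinite_finite_induct) (simp_all add: frag_of_mult)
  have 3: "m = (\<Sum>v\<in>Poly_Mapping.keys m. Poly_Mapping.single v (Poly_Mapping.lookup m v))"
    by (rule poly_mapping_eqI)
      (simp add: lookup_sum lookup_single when_def sum.delta in_keys_iff)
  show ?thesis
    unfolding monom_eval_def 1 2 using 3 by simp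
qed

lemma ipoly_eval_cong:
  assumes "\<And>m v. m \<in> Poly_Mapping.keys p \<Longrightarrow> v \<in> Poly_Mapping.keys m \<Longrightarrow> f v = g v"
  shows "ipoly_eval f p = ipoly_eval g p"
  unfolding ipoly_eval_def monom_eval_def
  by (intro linear_ext_cong prod.cong) (use assms in auto)

lemma ipoly_eval_id: "ipoly_eval var p = p"
  by (rule frag_induction[of p UNIV])
    (auto simp: ipoly_eval_frag_of frag_of_eq_prod_var[symmetric] ipoly_eval_diff)

lemma ipoly_eval_compose: "ipoly_eval f (ipoly_eval g p) = ipoly_eval (\<lambda>v. ipoly_eval f (g v)) p"
  by (rule frag_induction[of p UNIV])
    (auto simp: ipoly_eval_frag_of monom_eval_def ipoly_eval_diff
       ipoly_eval.hom_prod ipoly_eval.hom_power)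

section \<open>Homogeneous polynomials\<close>

lemma weighted_deg_superset:
  assumes "finite A" "Poly_Mapping.keys m \<subseteq> A"
  shows "weighted_deg w m = (\<Sum>v\<in>A. w v * Poly_Mapping.lookup m v)"
  unfolding weighted_deg_def
  by (rule sum.mono_neutral_left) (use assms in \<open>auto simp: in_keys_iff\<close>)

lemma weighted_deg_add: "weighted_deg w (m + m') = weighted_deg w m + weighted_deg w m'"
proof -
  let ?A = "Poly_Mapping.keys m \<union> Poly_Mapping.keys m'"
  have "weighted_deg w (m + m') = (\<Sum>v\<in>?A. w v * Poly_Mapping.lookup (m + m') v)"
    by (rule weighted_deg_superset) (use keys_add[of m m'] in auto)
  moreover have "weighted_deg w m = (\<Sum>v\<in>?A. w v * Poly_Mapping.lookup m v)"
    by (rule weighted_deg_superset) auto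
  moreover have "weighted_deg w m' = (\<Sum>v\<in>?A. w v * Poly_Mapping.lookup m' v)"
    by (rule weighted_deg_superset) auto
  ultimately show ?thesis
    by (simp add: lookup_add algebra_simps sum.distrib)
qed

lemma weighted_deg_zero [simp]: "weighted_deg w 0 = 0"
  by (simp add: weighted_deg_def)

lemma weighted_deg_single [simp]: "weighted_deg w (Poly_Mapping.single v k) = w v * k"
  by (cases "k = 0") (simp_all add: weighted_deg_def)

lemma carrier_poly_over_iff:
  "p \<in> carrier (poly_over V) \<longleftrightarrow> (\<forall>m \<in> Poly_Mapping.keys p. Poly_Mapping.keys m \<subseteq> V)"
  by (simp add: poly_over_def)

lemma homogeneous_part_iff:
  "p \<in> homogeneous_part V w d \<longleftrightarrow>
     Poly_Mapping.keys p \<subseteq> {m. Poly_Mapping.keys m \<subseteq> V \<and> weighted_deg w m = d}"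
  by (auto simp: homogeneous_part_def carrier_poly_over_iff)

text \<open>With all weights zero, degree zero is no condition, so that the closure properties of
  polynomials over \<open>V\<close> are instances of those of homogeneous polynomials.\<close>

lemma carrier_poly_over_eq_homogeneous_part:
  "carrier (poly_over V) = homogeneous_part V (\<lambda>_. 0) 0"
  by (auto simp: homogeneous_part_def weighted_deg_def)

lemma homogeneous_part_zero: "0 \<in> homogeneous_part V w d"
  by (simp add: homogeneous_part_iff)

lemma homogeneous_part_add:
  "p \<in> homogeneous_part V w d \<Longrightarrow> q \<in> homogeneous_part V w d \<Longrightarrow> p + q \<in> homogeneous_part V w d"
  unfolding homogeneous_part_iff using keys_add[of p q] by blast

lemma homogeneous_part_uminus:
  "p \<in> homogeneous_part V w d \<Longrightarrow> - p \<in> homogeneous_part V w d"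
  by (auto simp: homogeneous_part_iff)

lemma homogeneous_part_diff:
  "p \<in> homogeneous_part V w d \<Longrightarrow> q \<in> homogeneous_part V w d \<Longrightarrow> p - q \<in> homogeneous_part V w d"
  using homogeneous_part_add[of p V w d "- q"] homogeneous_part_uminus[of q V w d] by simp

lemma homogeneous_part_sum:
  "(\<And>a. a \<in> A \<Longrightarrow> f a \<in> homogeneous_part V w d) \<Longrightarrow> sum f A \<in> homogeneous_part V w d"
  by (induction A rule: infinite_finite_induct)
    (auto intro: homogeneous_part_zero homogeneous_part_add)

lemma homogeneous_part_one: "1 \<in> homogeneous_part V w 0"
  by (simp add: homogeneous_part_iff)

lemma homogeneous_part_mult:
  assumes "p \<in> homogeneous_part V w d" "q \<in> homogeneous_part V w e"
  shows "p * q \<in> homogeneous_part V w (d + e)"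
  unfolding homogeneous_part_iff
proof
  fix m assume "m \<in> Poly_Mapping.keys (p * q)"
  then obtain a b where ab: "m = a + b" "a \<in> Poly_Mapping.keys p" "b \<in> Poly_Mapping.keys q"
    using keys_mult[of p q] by auto
  show "m \<in> {m. Poly_Mapping.keys m \<subseteq> V \<and> weighted_deg w m = d + e}"
    using assms ab keys_add[of a b] by (force simp: homogeneous_part_iff weighted_deg_add)
qed

lemma homogeneous_part_power:
  "p \<in> homogeneous_part V w d \<Longrightarrow> p ^ k \<in> homogeneous_part V w (d * k)"
  by (induction k) (auto intro: homogeneous_part_one homogeneous_part_mult)

lemma homogeneous_part_prod:
  "(\<And>a. a \<in> A \<Longrightarrow> f a \<in> homogeneous_part V w (d a)) \<Longrightarrow>
     prod f A \<in> homogeneous_part V w (sum d A)"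
  by (induction A rule: infinite_finite_induct)
    (auto intro: homogeneous_part_one homogeneous_part_mult)

lemma homogeneous_part_minus_one_power: "(- 1) ^ k \<in> homogeneous_part V w 0"
  using homogeneous_part_power[OF homogeneous_part_uminus[OF homogeneous_part_one]] by simp

lemma homogeneous_part_var: "v \<in> V \<Longrightarrow> var v \<in> homogeneous_part V w (w v)"
  by (simp add: homogeneous_part_iff var_def)

lemma homogeneous_part_carrier: "homogeneous_part V w d \<subseteq> carrier (poly_over V)"
  by (auto simp: homogeneous_part_def)

lemma ipoly_eval_homogeneous:
  assumes "p \<in> homogeneous_part V w d" "\<And>v. v \<in> V \<Longrightarrow> f v \<in> homogeneous_part V' w' (w v)"
  shows "ipoly_eval f p \<in> homogeneous_part V' w' d"
proof (rule frag_induction[of p "{m. Poly_Mapping.keys m \<subseteq> V \<and> weighted_deg w m = d}"])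
  show "Poly_Mapping.keys p \<subseteq> {m. Poly_Mapping.keys m \<subseteq> V \<and> weighted_deg w m = d}"
    using assms(1) by (simp add: homogeneous_part_iff)
  fix m assume m: "m \<in> {m. Poly_Mapping.keys m \<subseteq> V \<and> weighted_deg w m = d}"
  show "ipoly_eval f (frag_of m) \<in> homogeneous_part V' w' d"
    using homogeneous_part_prod[of "Poly_Mapping.keys m" "\<lambda>v. f v ^ Poly_Mapping.lookup m v" V' w'
      "\<lambda>v. w v * Poly_Mapping.lookup m v"] m assms(2)
    by (auto simp: ipoly_eval_frag_of monom_eval_def weighted_deg_def intro!: homogeneous_part_power)
qed (auto simp: ipoly_eval_diff intro: homogeneous_part_zero homogeneous_part_diff)

lemma ipoly_eval_carrier:
  assumes "p \<in> carrier (poly_over V)" "\<And>v. v \<in> V \<Longrightarrow> f v \<in> carrier (poly_over V')"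
  shows "ipoly_eval f p \<in> carrier (poly_over V')"
  using ipoly_eval_homogeneous[of p V "\<lambda>_. 0" 0 f V' "\<lambda>_. 0"] assms
  by (simp add: carrier_poly_over_eq_homogeneous_part)

section \<open>Characteristic polynomials of Hessenberg matrices\<close>

text \<open>Laplace expansion along the last row meets only its last entry and the subdiagonal 1.
  Deleting the column of that 1 leaves a smaller matrix of the same shape whose last column is again
  \<open>v\<close>; for this reason the induction decouples the last column from
  \<open>C\<close>.\<close>

lemma det_hessenberg_last_column:
  fixes C :: "nat \<Rightarrow> nat \<Rightarrow> 'a::comm_ring_1"
  assumes sub: "\<And>b. C (Suc b) b = 1" and below: "\<And>a b. a > Suc b \<Longrightarrow> C a b = 0"
  shows "det (mat (Suc j) (Suc j) (\<lambda>(a, b). if b = j then v a else C a b)) =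
    (\<Sum>a\<le>j. (- 1) ^ (j - a) * v a * det (mat a a (\<lambda>(a, b). C a b)))"
proof (induction j)
  case 0
  show ?case by (simp add: det_single)
next
  case (Suc j)
  let ?M = "mat (Suc (Suc j)) (Suc (Suc j)) (\<lambda>(a, b). if b = Suc j then v a else C a b)"
  have m1: "mat_delete ?M (Suc j) (Suc j) = mat (Suc j) (Suc j) (\<lambda>(a, b). C a b)"
    by (rule eq_matI) (auto simp: mat_delete_def)
  have m2: "mat_delete ?M (Suc j) j = mat (Suc j) (Suc j) (\<lambda>(a, b). if b = j then v a else C a b)"
    by (rule eq_matI) (auto simp: mat_delete_def)
  have "det ?M = (\<Sum>b<Suc (Suc j). ?M $$ (Suc j, b) * cofactor ?M (Suc j) b)"
    by (rule laplace_expansion_row) auto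
  also have "\<dots> = (\<Sum>b\<in>{j, Suc j}. ?M $$ (Suc j, b) * cofactor ?M (Suc j) b)"
    by (rule sum.mono_neutral_right) (auto simp: below)
  also have "\<dots> = v (Suc j) * det (mat (Suc j) (Suc j) (\<lambda>(a, b). C a b)) -
     det (mat (Suc j) (Suc j) (\<lambda>(a, b). if b = j then v a else C a b))"
    by (simp add: cofactor_def m1 m2 sub)
  also have "\<dots> = (\<Sum>a\<le>Suc j. (- 1) ^ (Suc j - a) * v a * det (mat a a (\<lambda>(a, b). C a b)))"
    unfolding Suc.IH by (simp add: Suc_diff_le sum_negf[symmetric])
  finally show ?case .
qed

abbreviation P_poly :: "nat \<Rightarrow> xq ipoly poly" where
  "P_poly j \<equiv> char_poly (M_mat j)"

text \<open>The signed entries of the last column of \<open>M_mat j\<close>, for which the characteristic polynomials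
  satisfy a recurrence without alternating signs.\<close>

definition y_poly :: "nat \<Rightarrow> nat \<Rightarrow> xq ipoly" where
  "y_poly a j = (if a = j then var (X j) else (- 1) ^ (j - a) * var (Q a j))"

lemma P_poly_Suc:
  "P_poly (Suc j) = pCons 0 (P_poly j) - (\<Sum>a\<le>j. Polynomial.smult (y_poly (Suc a) (Suc j)) (P_poly a))"
proof -
  define C :: "nat \<Rightarrow> nat \<Rightarrow> xq ipoly poly" where
    "C a b = (if a = b then [:- var (X (a + 1)), 1:]
      else if a < b then [:- var (Q (a + 1) (b + 1)):] else if a = b + 1 then 1 else 0)" for a b
  have P: "P_poly k = det (mat k k (\<lambda>(a, b). C a b))" for k
    unfolding char_poly_def
    by (rule arg_cong[where f = det], rule eq_matI)
      (auto simp: char_poly_matrix_def M_mat_def C_def one_pCons)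
  have "P_poly (Suc j) = det (mat (Suc j) (Suc j) (\<lambda>(a, b). if b = j then C a j else C a b))"
    unfolding P by (rule arg_cong[where f = det], rule eq_matI) auto
  also have "\<dots> = (\<Sum>a\<le>j. (- 1) ^ (j - a) * C a j * P_poly a)"
    unfolding P by (rule det_hessenberg_last_column) (auto simp: C_def)
  \<comment> \<open>The diagonal entry t - x_{j+1} supplies the shift t P_j. For
    \<open>a < j\<close> the sign of the expansion is the one built into
    \<open>y_poly\<close>.\<close>
  also have "\<dots> = (\<Sum>a\<le>j. (if a = j then pCons 0 (P_poly j) else 0) -
      Polynomial.smult (y_poly (Suc a) (Suc j)) (P_poly a))"
  proof (rule sum.cong[OF refl])
    fix a assume "a \<in> {..j}"
    moreover have "[:- var (Q (Suc a) (Suc j)):] * P_poly a = - Polynomial.smult (var (Q (Suc a) (Suc j))) (P_poly a)"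
      by simp
    moreover have "(- 1) ^ k * p = Polynomial.smult ((- 1) ^ k) p" for k and p :: "xq ipoly poly"
      by (cases "even k") auto
    ultimately show "(- 1) ^ (j - a) * C a j * P_poly a =
      (if a = j then pCons 0 (P_poly j) else 0) - Polynomial.smult (y_poly (Suc a) (Suc j)) (P_poly a)"
      by (auto simp: C_def y_poly_def mult.assoc)
  qed
  also have "\<dots> = pCons 0 (P_poly j) - (\<Sum>a\<le>j. Polynomial.smult (y_poly (Suc a) (Suc j)) (P_poly a))"
    by (simp add: sum_subtractf)
  finally show ?thesis .
qed

lemma degree_P_poly: "Polynomial.degree (P_poly j) = j"
  and coeff_P_poly_self: "poly.coeff (P_poly j) j = 1"
  using degree_monic_char_poly[of "M_mat j" j] by (auto simp: M_mat_def)

lemma coeff_P_poly_eq_0: "k > j \<Longrightarrow> poly.coeff (P_poly j) k = 0"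
  by (simp add: coeff_eq_0 degree_P_poly)

lemma coeff_P_poly_Suc:
  "poly.coeff (P_poly (Suc j)) k = (case k of 0 \<Rightarrow> 0 | Suc k' \<Rightarrow> poly.coeff (P_poly j) k') -
     (\<Sum>a\<le>j. y_poly (Suc a) (Suc j) * poly.coeff (P_poly a) k)"
  by (simp add: P_poly_Suc coeff_pCons coeff_sum split: nat.split)

lemma P_poly_0: "P_poly 0 = 1"
  by (simp add: char_poly_def M_mat_def char_poly_matrix_def)

lemma E_poly_0 [simp]: "E_poly 0 j = 1"
  by (simp add: E_poly_def coeff_P_poly_self)

lemma coeff_P_poly_eq_E_poly:
  "k \<le> j \<Longrightarrow> poly.coeff (P_poly j) k = (- 1) ^ (j - k) * E_poly (j - k) j"
  by (simp add: E_poly_def mult.assoc[symmetric] power_add[symmetric])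

lemma y_poly_homogeneous:
  assumes "1 \<le> a" "a \<le> j" "j \<le> n"
  shows "y_poly a j \<in> homogeneous_part (XQ_vars n) xq_deg (2 * (j - a + 1))"
proof (cases "a = j")
  case True
  then show ?thesis
    using homogeneous_part_var[of "X j" "XQ_vars n" xq_deg] assms
    by (simp add: y_poly_def XQ_vars_def)
next
  case False
  then show ?thesis
    using homogeneous_part_mult[OF homogeneous_part_minus_one_power
      homogeneous_part_var[of "Q a j" "XQ_vars n" xq_deg], of "j - a"] assms
    by (simp add: y_poly_def XQ_vars_def)
qed

lemma coeff_P_poly_homogeneous:
  "j \<le> n \<Longrightarrow> k \<le> j \<Longrightarrow> poly.coeff (P_poly j) k \<in> homogeneous_part (XQ_vars n) xq_deg (2 * (j - k))"
proof (induction j arbitrary: k rule: less_induct)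
  case (less j)
  show ?case
  proof (cases j)
    case 0
    then show ?thesis using less.prems by (simp add: P_poly_0 homogeneous_part_one)
  next
    case (Suc i)
    have "(case k of 0 \<Rightarrow> 0 | Suc k' \<Rightarrow> poly.coeff (P_poly i) k')
        \<in> homogeneous_part (XQ_vars n) xq_deg (2 * (j - k))"
      using less.IH[of i "k - 1"] less.prems Suc
      by (auto simp: homogeneous_part_zero split: nat.split)
    moreover have "y_poly (Suc a) (Suc i) * poly.coeff (P_poly a) k
        \<in> homogeneous_part (XQ_vars n) xq_deg (2 * (j - k))" if "a \<le> i" for a
    proof (cases "k \<le> a")
      case True
      then have "2 * (j - k) = 2 * (Suc i - Suc a + 1) + 2 * (a - k)"
        using that Suc by simp
      then show ?thesis
        using homogeneous_part_mult[OF y_poly_homogeneous[of "Suc a" "Suc i" n] less.IH[of a k]]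
          less.prems that Suc True by simp
    qed (simp add: coeff_P_poly_eq_0 homogeneous_part_zero)
    ultimately show ?thesis
      unfolding Suc coeff_P_poly_Suc
      by (intro homogeneous_part_diff homogeneous_part_sum) auto
  qed
qed

lemma E_poly_homogeneous:
  assumes "j \<le> n"
  shows "E_poly i j \<in> homogeneous_part (XQ_vars n) xq_deg (2 * i)"
proof (cases "i \<le> j")
  case True
  then show ?thesis
    using homogeneous_part_mult[OF homogeneous_part_minus_one_power
      coeff_P_poly_homogeneous[of j n "j - i"], of i] assms
    by (simp add: E_poly_def)
qed (simp add: E_poly_def homogeneous_part_zero)

section \<open>Independence of the standard elementary monomials\<close>

text \<open>Ring elements in place of variables and an arbitrary index set: below, points are
  evaluated and indices are deleted and permuted.\<close>

definition esym :: "('b \<Rightarrow> 'a::comm_ring_1) \<Rightarrow> 'b set \<Rightarrow> nat \<Rightarrow> 'a" where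
  "esym x A i = (\<Sum>S | S \<subseteq> A \<and> card S = i. \<Prod>k\<in>S. x k)"

lemma esym_0 [simp]:
  assumes "finite A"
  shows "esym x A 0 = 1"
proof -
  have "{S. S \<subseteq> A \<and> card S = 0} = {{}}"
    using assms by (auto dest: finite_subset)
  then show ?thesis by (simp add: esym_def)
qed

lemma esym_insert:
  assumes A: "finite A" "a \<notin> A"
  shows "esym x (insert a A) (Suc i) = esym x A (Suc i) + x a * esym x A i"
proof -
  let ?F = "\<lambda>B i. {S. S \<subseteq> B \<and> card S = i}"
  have card_insert: "card (insert a S) = Suc (card S)" if "S \<subseteq> A" for S
    using that A by (metis card_insert_disjoint finite_subset subsetD)
  have split: "?F (insert a A) (Suc i) = ?F A (Suc i) \<union> insert a ` ?F A i"
  proof (intro equalityI subsetI)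
    fix S assume S: "S \<in> ?F (insert a A) (Suc i)"
    show "S \<in> ?F A (Suc i) \<union> insert a ` ?F A i"
    proof (cases "a \<in> S")
      case True
      then have "S = insert a (S - {a})" "S - {a} \<in> ?F A i"
        using S by auto
      then show ?thesis by blast
    qed (use S in auto)
  qed (use A in \<open>auto simp: card_insert\<close>)
  have inj: "inj_on (insert a) (?F A i)"
  proof (rule inj_onI)
    fix S T assume "S \<in> ?F A i" "T \<in> ?F A i" "insert a S = insert a T"
    moreover from this A have "a \<notin> S" "a \<notin> T" by auto
    ultimately show "S = T" by (metis insert_ident)
  qed
  have "(\<Sum>S\<in>insert a ` ?F A i. \<Prod>k\<in>S. x k) = (\<Sum>S\<in>?F A i. \<Prod>k\<in>insert a S. x k)"
    by (simp add: sum.reindex[OF inj])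
  also have "\<dots> = (\<Sum>S\<in>?F A i. x a * (\<Prod>k\<in>S. x k))"
    using A by (intro sum.cong refl prod.insert) (auto dest: finite_subset)
  finally show ?thesis
    unfolding esym_def split using A
    by (subst sum.union_disjoint) (auto simp: sum_distrib_left)
qed

text \<open>Used for transpositions: if \<open>\<pi>\<close> preserves \<open>A\<close>, this is the
  symmetry of \<open>esym x A\<close>; if it carries \<open>A\<close> onto another set, it produces
  \<open>esym\<close> with a different index left out.\<close>

lemma esym_reindex:
  assumes "inj_on \<pi> A"
  shows "esym (\<lambda>k. x (\<pi> k)) A i = esym x (\<pi> ` A) i"
proof -
  have inj: "inj_on (image \<pi>) {S. S \<subseteq> A \<and> card S = i}"
    using assms by (auto simp: inj_on_def inj_on_image_eq_iff[OF assms])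
  have im: "image \<pi> ` {S. S \<subseteq> A \<and> card S = i} = {S. S \<subseteq> \<pi> ` A \<and> card S = i}"
  proof (intro equalityI subsetI)
    fix T assume T: "T \<in> {S. S \<subseteq> \<pi> ` A \<and> card S = i}"
    then obtain S where S: "S \<subseteq> A" "T = \<pi> ` S" by (auto simp: subset_image_iff)
    then show "T \<in> image \<pi> ` {S. S \<subseteq> A \<and> card S = i}"
      using T assms by (auto simp: card_image inj_on_subset)
  qed (use assms in \<open>auto simp: card_image inj_on_subset\<close>)
  have "esym x (\<pi> ` A) i = (\<Sum>S | S \<subseteq> A \<and> card S = i. \<Prod>k\<in>\<pi> ` S. x k)"
    unfolding esym_def im[symmetric] by (simp add: sum.reindex[OF inj])
  also have "\<dots> = esym (\<lambda>k. x (\<pi> k)) A i"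
    unfolding esym_def
    by (intro sum.cong refl, subst prod.reindex)
      (use assms in \<open>auto intro: inj_on_subset\<close>)
  finally show ?thesis ..
qed

text \<open>In generating functions: the product of the 1 + x_b t over \<open>A\<close> is divided
  by 1 + x_a t, whose inverse is a geometric series.\<close>

lemma esym_remove:
  assumes "finite A" "a \<in> A"
  shows "esym x (A - {a}) i = (\<Sum>s\<le>i. (- x a) ^ s * esym x A (i - s))"
proof (induction i)
  case 0
  show ?case using assms by simp
next
  case (Suc i)
  have "esym x (A - {a}) (Suc i) = esym x A (Suc i) - x a * esym x (A - {a}) i"
    using esym_insert[of "A - {a}" a x i] assms by (simp add: insert_absorb)
  also have "\<dots> = (\<Sum>s\<le>Suc i. (- x a) ^ s * esym x A (Suc i - s))"
    unfolding Suc.IH by (subst sum.atMost_Suc_shift) (simp add: sum_distrib_left mult.assoc sum_negf)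
  finally show ?case .
qed

text \<open>By \<open>esym_remove\<close>, the hypothesis says that a polynomial of degree at most \<open>k\<close> vanishes at
  the \<open>k + 1\<close> points \<open>x a\<close>.\<close>

lemma esym_remove_independent:
  fixes x :: "'b \<Rightarrow> 'a::idom"
  assumes A: "finite A" "card A = Suc k" and inj: "inj_on x A"
    and zero: "\<And>a. a \<in> A \<Longrightarrow> (\<Sum>i\<le>k. esym x (A - {a}) i * g i) = 0"
    and i: "i \<le> k"
  shows "g i = 0"
proof -
  \<comment> \<open>\<open>b s\<close> collects the coefficient of \<open>(x a) ^ s\<close> after
    \<open>esym_remove\<close> is inserted into the relation; it does not depend on
    \<open>a\<close>.\<close>
  define b where "b s = (\<Sum>i\<in>{s..k}. (- 1) ^ s * esym x A (i - s) * g i)" for s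
  define F where "F = (\<Sum>s\<le>k. Polynomial.monom (b s) s)"
  have coeff_F: "poly.coeff F s = (if s \<le> k then b s else 0)" for s
    by (simp add: F_def coeff_sum)
  have "poly F (x a) = 0" if a: "a \<in> A" for a
  proof -
    have "poly F (x a) = (\<Sum>s\<le>k. \<Sum>i\<in>{s..k}. (- x a) ^ s * esym x A (i - s) * g i)"
      by (simp add: F_def poly_sum poly_monom b_def sum_distrib_left power_minus[of "x a"] ac_simps)
    also have "\<dots> = (\<Sum>i\<le>k. \<Sum>s\<le>i. (- x a) ^ s * esym x A (i - s) * g i)"
      unfolding sum.Sigma[OF finite_atMost ballI[OF finite_atLeastAtMost]]
        sum.Sigma[OF finite_atMost ballI[OF finite_atMost]]
      by (rule sum.reindex_bij_witness[of _ "\<lambda>(i, s). (s, i)" "\<lambda>(s, i). (i, s)"]) auto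
    also have "\<dots> = (\<Sum>i\<le>k. esym x (A - {a}) i * g i)"
      by (simp add: esym_remove[OF A(1) a] sum_distrib_right)
    finally show ?thesis using zero[OF a] by simp
  qed
  then have roots: "x ` A \<subseteq> {z. poly F z = 0}" by auto
  have "F = 0"
  proof (rule ccontr)
    assume F: "F \<noteq> 0"
    have "Suc k = card (x ` A)" using A inj by (simp add: card_image)
    also have "\<dots> \<le> card {z. poly F z = 0}"
      using roots poly_roots_finite[OF F] by (rule card_mono[rotated])
    also have "\<dots> \<le> Polynomial.degree F" by (rule card_poly_roots_bound[OF F])
    also have "\<dots> \<le> k" by (rule degree_le) (simp add: coeff_F)
    finally show False by simp
  qed
  then have b: "b s = 0" if "s \<le> k" for s
    using coeff_F[of s] that by simp
  \<comment> \<open>The system \<open>b s = 0\<close> is triangular in the \<open>g i\<close> with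
    diagonal entries \<open>(- 1) ^ s\<close>, so the \<open>g i\<close> vanish from
    \<open>i = k\<close> downwards.\<close>
  show ?thesis
    using i
  proof (induction "k - i" arbitrary: i rule: less_induct)
    case less
    have "b i = (\<Sum>j\<in>{i}. (- 1) ^ i * esym x A (j - i) * g j)"
      unfolding b_def using less by (intro sum.mono_neutral_right) auto
    then show ?case
      using b[OF less.prems] A(1) by simp
  qed
qed

text \<open>The smallest level \<open>k\<close> is peeled off. The cofactor \<open>g x i\<close> of
  \<open>esym x {1..k} i\<close> involves only the sets \<open>{1..l}\<close> with
  \<open>l > k\<close>, so it is symmetric in the first \<open>k + 1\<close> coordinates.
  Transposing \<open>a\<close> with \<open>k + 1\<close> therefore gives, for each
  \<open>a \<le> k + 1\<close>, a relation with the same cofactors but with \<open>{1..k}\<close>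
  replaced by \<open>{1..k+1}\<close> without \<open>a\<close>; these force
  \<open>g x i = 0\<close>. Injective points are stable under permutation and keep the
  \<open>k + 1\<close> coordinates distinct.\<close>

lemma esym_products_independent:
  fixes c :: "(nat \<Rightarrow> nat) \<Rightarrow> int"
  assumes "k \<le> m" "finite F" "\<And>I l. I \<in> F \<Longrightarrow> I l \<le> l" "\<And>I l. I \<in> F \<Longrightarrow> l \<notin> {k..<m} \<Longrightarrow> I l = 0"
    and "\<And>x::nat \<Rightarrow> int. inj x \<Longrightarrow> (\<Sum>I\<in>F. c I * (\<Prod>l\<in>{k..<m}. esym x {1..l} (I l))) = 0"
    and "I \<in> F"
  shows "c I = 0"
  using assms
proof (induction arbitrary: F c I rule: inc_induct)
  case base
  have "J = I" if "J \<in> F" for J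
    by (rule ext) (use base.prems(3)[OF that] base.prems(3)[OF base.prems(5)] in auto)
  then have "F = {I}" using base.prems(5) by blast
  then show ?case using base.prems(4)[of int] by simp
next
  case (step k)
  \<comment> \<open>Entry \<open>k\<close> is reset to 0 because the induction hypothesis concerns
    functions vanishing outside \<open>{Suc k..<m}\<close>.\<close>
  define G where "G i = {J. J k = 0 \<and> J(k := i) \<in> F}" for i
  have G: "G i = (\<lambda>I. I(k := 0)) ` {I \<in> F. I k = i}" for i
  proof (intro equalityI subsetI)
    fix J assume "J \<in> G i"
    then show "J \<in> (\<lambda>I. I(k := 0)) ` {I \<in> F. I k = i}"
      by (intro image_eqI[of _ _ "J(k := i)"]) (auto simp: G_def fun_upd_idem)
  qed (auto simp: G_def fun_upd_idem)
  have finG: "finite (G i)" for i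
    unfolding G using step.prems(1) by simp
  define g where "g x i = (\<Sum>J\<in>G i. c (J(k := i)) * (\<Prod>l\<in>{Suc k..<m}. esym x {1..l} (J l)))"
    for x :: "nat \<Rightarrow> int" and i
  have expand: "(\<Sum>I\<in>F. c I * (\<Prod>l\<in>{k..<m}. esym x {1..l} (I l))) = (\<Sum>i\<le>k. esym x {1..k} i * g x i)" for x
  proof -
    have "(\<Sum>I\<in>F. c I * (\<Prod>l\<in>{k..<m}. esym x {1..l} (I l))) =
        (\<Sum>i\<le>k. \<Sum>I | I \<in> F \<and> I k = i. c I * (\<Prod>l\<in>{k..<m}. esym x {1..l} (I l)))"
      by (rule sum.group[symmetric]) (use step.prems in auto)
    also have "\<dots> = (\<Sum>i\<le>k. esym x {1..k} i * g x i)"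
    proof (rule sum.cong[OF refl])
      fix i
      have "(\<Sum>I | I \<in> F \<and> I k = i. c I * (\<Prod>l\<in>{k..<m}. esym x {1..l} (I l))) =
          (\<Sum>J\<in>G i. esym x {1..k} i * (c (J(k := i)) * (\<Prod>l\<in>{Suc k..<m}. esym x {1..l} (J l))))"
        using step.hyps
        by (intro sum.reindex_bij_witness[of _ "\<lambda>J. J(k := i)" "\<lambda>I. I(k := 0)"])
          (auto simp: G_def prod.atLeast_Suc_lessThan[of k m] fun_upd_idem intro!: prod.cong)
      then show "(\<Sum>I | I \<in> F \<and> I k = i. c I * (\<Prod>l\<in>{k..<m}. esym x {1..l} (I l))) = esym x {1..k} i * g x i"
        by (simp add: g_def sum_distrib_left)
    qed
    finally show ?thesis .
  qed
  have g0: "g x i = 0" if x: "inj x" and i: "i \<le> k" for x i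
  proof (rule esym_remove_independent[of "{1..Suc k}" k x])
    show "inj_on x {1..Suc k}" using x by (rule inj_on_subset) simp
    fix a assume a: "a \<in> {1..Suc k}"
    let ?\<pi> = "Transposition.transpose a (Suc k)"
    have im: "?\<pi> ` {1..l} = {1..l}" if "l \<ge> Suc k" for l
      using a that by (intro transpose_image_eq) auto
    have im': "?\<pi> ` {1..k} = {1..Suc k} - {a}"
    proof -
      have "{1..k} = {1..Suc k} - {Suc k}" by auto
      then have "?\<pi> ` {1..k} = ?\<pi> ` {1..Suc k} - ?\<pi> ` {Suc k}"
        by (simp only: image_set_diff[OF inj_transpose])
      then show ?thesis unfolding im[OF order_refl] by simp
    qed
    have inj\<pi>: "inj_on ?\<pi> B" for B
      by (rule inj_on_subset[OF inj_transpose]) simp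
    have "inj (\<lambda>k. x (?\<pi> k))"
      using inj_compose[OF x inj_transpose] by (simp add: comp_def)
    then have "(\<Sum>i\<le>k. esym (\<lambda>k. x (?\<pi> k)) {1..k} i * g (\<lambda>k. x (?\<pi> k)) i) = 0"
      using step.prems(4) unfolding expand[symmetric] by blast
    moreover have "g (\<lambda>k. x (?\<pi> k)) i = g x i" for i
      unfolding g_def esym_reindex[OF inj\<pi>]
      by (intro sum.cong prod.cong arg_cong2[where f = "(*)"] refl, subst im) auto
    ultimately show "(\<Sum>i\<le>k. esym x ({1..Suc k} - {a}) i * g x i) = 0"
      unfolding esym_reindex[OF inj\<pi>] im' by simp
  qed (use i in auto)
  have "c ((I(k := 0))(k := I k)) = 0"
  proof (rule step.IH[of "G (I k)" "\<lambda>J. c (J(k := I k))"])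
    show "finite (G (I k))" by (rule finG)
    show "I(k := 0) \<in> G (I k)" using step.prems by (auto simp: G_def fun_upd_idem)
    fix J l assume J: "J \<in> G (I k)"
    then obtain I' where "I' \<in> F" "J = I'(k := 0)" by (auto simp: G)
    then show "J l \<le> l"
      using step.prems(2)[of I' l] by auto
    show "J l = 0" if "l \<notin> {Suc k..<m}"
      using step.prems(3)[of I' l] that \<open>I' \<in> F\<close> \<open>J = I'(k := 0)\<close> by auto
  next
    fix x :: "nat \<Rightarrow> int" assume "inj x"
    then show "(\<Sum>J\<in>G (I k). c (J(k := I k)) * (\<Prod>l\<in>{Suc k..<m}. esym x {1..l} (J l))) = 0"
      using g0[of x "I k"] step.prems(2)[OF step.prems(5)] by (simp add: g_def)
  qed
  then show ?case by (simp add: fun_upd_idem)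
qed

lemma e_poly_eq_esym: "e_poly i j = esym (\<lambda>k. var (X k)) {1..j} i"
  by (simp add: e_poly_def esym_def)

lemma e_poly_0 [simp]: "e_poly 0 j = 1"
  by (simp add: e_poly_eq_esym)

text \<open>This is what makes the description in \<open>e_coeffs\<close> determinate as soon as one
  expansion is exhibited. A relation between polynomials is weakened to its values at integer
  points, where \<open>esym_products_independent\<close> applies.\<close>

lemma e_monomial_independent:
  assumes keys: "Poly_Mapping.keys d \<subseteq> std_seqs" and zero: "linear_ext e_monomial d = 0"
  shows "d = 0"
proof -
  \<comment> \<open>\<open>m\<close> exceeds every index in use, with \<open>insert 0\<close>
    keeping the set nonempty. All products can then range over \<open>{0..<m}\<close>, since absent
    entries contribute \<open>esym x {1..l} 0 = 1\<close>.\<close>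
  define m where "m = Suc (Max (insert 0 (\<Union>I\<in>Poly_Mapping.keys d. Poly_Mapping.keys I)))"
  have m: "Poly_Mapping.keys I \<subseteq> {0..<m}" if "I \<in> Poly_Mapping.keys d" for I
    unfolding m_def using that by (auto simp: less_Suc_eq_le intro!: Max_ge)
  let ?F = "Poly_Mapping.lookup ` Poly_Mapping.keys d"
  let ?c = "\<lambda>f. Poly_Mapping.lookup d (Abs_poly_mapping f)"
  have inv: "Abs_poly_mapping (Poly_Mapping.lookup I) = I" for I :: "nat \<Rightarrow>\<^sub>0 nat"
    by (rule lookup_inverse)
  have inj: "inj_on Poly_Mapping.lookup (Poly_Mapping.keys d)"
    by (rule inj_onI) (simp add: lookup_inject)
  have "?c (Poly_Mapping.lookup I) = 0" if I: "I \<in> Poly_Mapping.keys d" for I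
  proof (rule esym_products_independent[of 0 m ?F ?c])
    fix J l assume "J \<in> ?F"
    then obtain I' where I': "I' \<in> Poly_Mapping.keys d" "J = Poly_Mapping.lookup I'" by auto
    show "J l \<le> l" using I' keys by (auto simp: std_seqs_def)
    show "J l = 0" if "l \<notin> {0..<m}"
      using that m[OF I'(1)] by (metis I'(2) in_keys_iff subsetD)
  next
    fix x :: "nat \<Rightarrow> int"
    define v where "v = (\<lambda>u. case u of X k \<Rightarrow> x k | Q _ _ \<Rightarrow> 0)"
    have ev_e: "ipoly_eval v (e_poly i k) = esym x {1..k} i" for i k
      by (simp add: e_poly_def esym_def ipoly_eval.hom_sum ipoly_eval.hom_prod v_def)
    have "0 = ipoly_eval v (linear_ext e_monomial d)" by (simp add: zero)
    also have "\<dots> = (\<Sum>I\<in>Poly_Mapping.keys d. Poly_Mapping.lookup d I * ipoly_eval v (e_monomial I))"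
      by (simp add: linear_ext_def ipoly_eval.hom_sum ipoly_eval.hom_mult ipoly_eval.hom_of_int)
    also have "\<dots> = (\<Sum>I\<in>Poly_Mapping.keys d. Poly_Mapping.lookup d I *
        (\<Prod>l\<in>{0..<m}. esym x {1..l} (Poly_Mapping.lookup I l)))"
    proof (intro sum.cong refl arg_cong2[where f = "(*)"])
      fix I assume I: "I \<in> Poly_Mapping.keys d"
      show "ipoly_eval v (e_monomial I) = (\<Prod>l\<in>{0..<m}. esym x {1..l} (Poly_Mapping.lookup I l))"
        unfolding e_monomial_def ipoly_eval.hom_prod ev_e
        by (rule prod.mono_neutral_left) (use m[OF I] in \<open>auto simp: in_keys_iff\<close>)
    qed
    also have "\<dots> = (\<Sum>f\<in>?F. ?c f * (\<Prod>l\<in>{0..<m}. esym x {1..l} (f l)))"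
      by (simp add: sum.reindex[OF inj] inv)
    finally show "(\<Sum>f\<in>?F. ?c f * (\<Prod>l\<in>{0..<m}. esym x {1..l} (f l))) = 0" ..
  qed (use I in auto)
  then show ?thesis
    by (metis inv in_keys_iff keys_eq_empty all_not_in_conv)
qed

section \<open>The recurrence for the quantized complete symmetric polynomials\<close>

definition monoms_of_degree :: "'v set \<Rightarrow> nat \<Rightarrow> ('v \<Rightarrow>\<^sub>0 nat) set" where
  "monoms_of_degree V i = {m. Poly_Mapping.keys m \<subseteq> V \<and> weighted_deg (\<lambda>_. 1) m = i}"

lemma weighted_deg_1_eq_0_iff [simp]: "weighted_deg (\<lambda>_. Suc 0) m = 0 \<longleftrightarrow> m = 0"
  by (auto simp: weighted_deg_def in_keys_iff intro: poly_mapping_eqI)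

lemma monoms_of_degree_0 [simp]: "monoms_of_degree V 0 = {0}"
  by (auto simp: monoms_of_degree_def)

lemma monoms_of_degree_empty [simp]: "monoms_of_degree {} (Suc i) = {}"
  by (auto simp: monoms_of_degree_def weighted_deg_def)

lemma monoms_of_degree_insert:
  "monoms_of_degree (insert v V) (Suc i) = monoms_of_degree V (Suc i) \<union>
     (+) (Poly_Mapping.single v 1) ` monoms_of_degree (insert v V) i"
proof (intro equalityI subsetI)
  fix m assume m: "m \<in> monoms_of_degree (insert v V) (Suc i)"
  show "m \<in> monoms_of_degree V (Suc i) \<union> (+) (Poly_Mapping.single v 1) ` monoms_of_degree (insert v V) i"
  proof (cases "v \<in> Poly_Mapping.keys m")
    case True
    define m' where "m' = m - Poly_Mapping.single v 1"
    have eq: "m = Poly_Mapping.single v 1 + m'"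
      using True by (intro poly_mapping_eqI) (auto simp: m'_def lookup_add lookup_minus lookup_single when_def in_keys_iff)
    have "Poly_Mapping.keys m' \<subseteq> Poly_Mapping.keys m"
      by (auto simp: m'_def in_keys_iff lookup_minus)
    then have "m' \<in> monoms_of_degree (insert v V) i"
      using m unfolding eq by (auto simp: monoms_of_degree_def weighted_deg_add)
    then show ?thesis unfolding eq by blast
  qed (use m in \<open>auto simp: monoms_of_degree_def\<close>)
next
  fix m assume "m \<in> monoms_of_degree V (Suc i) \<union> (+) (Poly_Mapping.single v 1) ` monoms_of_degree (insert v V) i"
  then consider "m \<in> monoms_of_degree V (Suc i)"
    | m' where "m = Poly_Mapping.single v 1 + m'" "m' \<in> monoms_of_degree (insert v V) i" by auto
  then show "m \<in> monoms_of_degree (insert v V) (Suc i)"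
  proof cases
    case 2
    then show ?thesis
      using keys_add[of "Poly_Mapping.single v 1" m']
      by (auto simp: monoms_of_degree_def weighted_deg_add)
  qed (auto simp: monoms_of_degree_def)
qed

lemma finite_monoms_of_degree: "finite V \<Longrightarrow> finite (monoms_of_degree V i)"
proof (induction V arbitrary: i rule: finite_induct)
  case empty
  show ?case by (cases i) auto
next
  case (insert v V)
  show ?case
    by (induction i) (auto simp: monoms_of_degree_insert insert.IH)
qed

definition hsym :: "'v set \<Rightarrow> nat \<Rightarrow> 'v ipoly" where
  "hsym V i = (\<Sum>m\<in>monoms_of_degree V i. frag_of m)"

lemma hsym_0 [simp]: "hsym V 0 = 1"
  by (simp add: hsym_def)

lemma hsym_empty [simp]: "hsym {} (Suc i) = 0"
  by (simp add: hsym_def)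

text \<open>Monomials are sorted by divisibility by \<open>v\<close>; the quotient by
  \<open>v\<close> may contain \<open>v\<close> again, hence \<open>insert v V\<close> in the second
  term.\<close>

lemma hsym_insert:
  assumes "finite V" "v \<notin> V"
  shows "hsym (insert v V) (Suc i) = hsym V (Suc i) + var v * hsym (insert v V) i"
proof -
  have disj: "monoms_of_degree V (Suc i) \<inter> (+) (Poly_Mapping.single v 1) ` monoms_of_degree (insert v V) i = {}"
  proof -
    have "v \<in> Poly_Mapping.keys (Poly_Mapping.single v 1 + m)" for m :: "'a \<Rightarrow>\<^sub>0 nat"
      by (simp add: in_keys_iff lookup_add)
    then show ?thesis using assms by (fastforce simp: monoms_of_degree_def)
  qed
  have "(\<Sum>m\<in>(+) (Poly_Mapping.single v 1) ` monoms_of_degree (insert v V) i. frag_of m) =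
      var v * hsym (insert v V) i"
    by (subst sum.reindex) (auto simp: hsym_def sum_distrib_left var_def frag_of_mult)
  moreover have "hsym (insert v V) (Suc i) = hsym V (Suc i) +
      (\<Sum>m\<in>(+) (Poly_Mapping.single v 1) ` monoms_of_degree (insert v V) i. frag_of m)"
    unfolding hsym_def monoms_of_degree_insert
    by (rule sum.union_disjoint) (use assms disj in \<open>auto simp: finite_monoms_of_degree\<close>)
  ultimately show ?thesis by simp
qed

lemma h_poly_eq_hsym: "h_poly i j = hsym (X ` {1..j}) i"
  by (simp add: h_poly_def hsym_def monoms_of_degree_def weighted_deg_def)

lemma h_poly_0 [simp]: "h_poly 0 j = 1"
  by (simp add: h_poly_eq_hsym)

lemma h_poly_Suc: "h_poly (Suc i) (Suc j) = h_poly (Suc i) j + var (X (Suc j)) * h_poly i (Suc j)"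
proof -
  have "X ` {1..Suc j} = insert (X (Suc j)) (X ` {1..j})"
    by (simp add: atLeastAtMostSuc_conv)
  then show ?thesis
    unfolding h_poly_eq_hsym by (simp add: hsym_insert image_iff)
qed

lemma e_poly_Suc: "e_poly (Suc i) (Suc j) = e_poly (Suc i) j + var (X (Suc j)) * e_poly i j"
proof -
  have "{1..Suc j} = insert (Suc j) {1..j}" by auto
  then show ?thesis
    unfolding e_poly_eq_esym by (simp add: esym_insert)
qed

lemma e_poly_Suc_0 [simp]: "e_poly (Suc i) 0 = 0"
  by (auto simp: e_poly_def intro: sum.neutral)

text \<open>The sum is the coefficient of t^i in the product of the 1 - x_m t over m <= j + d,
  divided by the same product over m <= j. What remains are the \<open>d\<close> factors with j < m
  <= j + d, a polynomial in t of degree at most \<open>d < i\<close>. The instance needed later has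
  \<open>d = i - 1\<close>.\<close>

lemma sum_e_poly_h_poly_eq_0:
  assumes "i > d"
  shows "(\<Sum>k\<le>i. (- 1) ^ k * e_poly k (j + d) * h_poly (i - k) j) = 0"
proof -
  define EE where "EE m = Abs_fps (\<lambda>k. (- 1) ^ k * e_poly k m)" for m
  define HH where "HH m = Abs_fps (\<lambda>k. h_poly k m)" for m
  \<comment> \<open>\<open>L m\<close> carries x_{m+1}, the variable that enters in passing from
    \<open>m\<close> to \<open>Suc m\<close>.\<close>
  define L where "L m = 1 - fps_const (var (X (Suc m))) * fps_X" for m
  have nth_L: "fps_nth (G * L m) (Suc k) = fps_nth G (Suc k) - var (X (Suc m)) * fps_nth G k" for G m k
    by (simp add: L_def algebra_simps)
  have EE_Suc: "EE (Suc m) = EE m * L m" for m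
  proof (rule fps_ext)
    fix k show "fps_nth (EE (Suc m)) k = fps_nth (EE m * L m) k"
      by (cases k) (simp_all add: EE_def L_def algebra_simps e_poly_Suc)
  qed
  have HH_Suc: "HH m = HH (Suc m) * L m" for m
  proof (rule fps_ext)
    fix k show "fps_nth (HH m) k = fps_nth (HH (Suc m) * L m) k"
      by (cases k) (simp_all add: HH_def L_def algebra_simps h_poly_Suc)
  qed
  have EH: "EE m * HH m = 1" for m
  proof (induction m)
    case 0
    have "EE 0 = 1"
    proof (rule fps_ext)
      fix k show "fps_nth (EE 0) k = fps_nth 1 k"
        by (cases k) (simp_all add: EE_def)
    qed
    moreover have "HH 0 = 1"
    proof (rule fps_ext)
      fix k show "fps_nth (HH 0) k = fps_nth 1 k"
        by (cases k) (simp_all add: HH_def h_poly_eq_hsym)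
    qed
    ultimately show ?case by simp
  next
    case (Suc m)
    have "EE (Suc m) * HH (Suc m) = EE m * (HH (Suc m) * L m)"
      by (simp add: EE_Suc mult_ac)
    then show ?case by (simp add: HH_Suc[symmetric] Suc)
  qed
  have "fps_nth (EE (j + d) * HH j) i = 0"
    using assms
  proof (induction d arbitrary: i)
    case 0
    then show ?case by (simp add: EH)
  next
    case (Suc d)
    have "EE (j + Suc d) * HH j = (EE (j + d) * HH j) * L (j + d)"
      by (simp add: EE_Suc mult_ac)
    with Suc show ?case
      by (cases i) (simp_all add: nth_L)
  qed
  then show ?thesis
    by (simp add: fps_mult_nth EE_def HH_def atLeast0AtMost)
qed

text \<open>The graph of quantization on the span of the standard monomials with entries below \<open>N\<close>.\<close>

inductive quantizes :: "nat \<Rightarrow> xq ipoly \<Rightarrow> xq ipoly \<Rightarrow> bool" for N where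
  zero: "quantizes N 0 0"
| monomial: "I \<in> std_seqs \<Longrightarrow> Poly_Mapping.keys I \<subseteq> {..<N} \<Longrightarrow> quantizes N (e_monomial I) (E_monomial I)"
| diff: "quantizes N f F \<Longrightarrow> quantizes N g G \<Longrightarrow> quantizes N (f - g) (F - G)"

lemma quantizes_mono: "quantizes N f F \<Longrightarrow> N \<le> N' \<Longrightarrow> quantizes N' f F"
proof (induction rule: quantizes.induct)
  case (monomial I)
  then show ?case by (intro quantizes.monomial) auto
qed (auto intro: quantizes.intros)

lemma quantizes_uminus: "quantizes N f F \<Longrightarrow> quantizes N (- f) (- F)"
  using quantizes.diff[OF quantizes.zero] by force

lemma quantizes_add: "quantizes N f F \<Longrightarrow> quantizes N g G \<Longrightarrow> quantizes N (f + g) (F + G)"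
  using quantizes.diff[OF _ quantizes_uminus] by force

lemma quantizes_sum:
  "(\<And>a. a \<in> A \<Longrightarrow> quantizes N (f a) (F a)) \<Longrightarrow> quantizes N (sum f A) (sum F A)"
  by (induction A rule: infinite_finite_induct) (auto intro: quantizes.zero quantizes_add)

lemma quantizes_one: "quantizes N 1 1"
  using quantizes.monomial[of 0 N] by (simp add: std_seqs_def e_monomial_def E_monomial_def)

lemma prod_keys_add_single:
  fixes B :: "nat \<Rightarrow> nat \<Rightarrow> 'a::comm_monoid_mult"
  assumes "\<And>l. B 0 l = 1" "Poly_Mapping.lookup I N = 0"
  shows "(\<Prod>l\<in>Poly_Mapping.keys (I + Poly_Mapping.single N k). B (Poly_Mapping.lookup (I + Poly_Mapping.single N k) l) l) =
    B k N * (\<Prod>l\<in>Poly_Mapping.keys I. B (Poly_Mapping.lookup I l) l)"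
proof -
  have N: "N \<notin> Poly_Mapping.keys I" using assms(2) by (simp add: in_keys_iff)
  \<comment> \<open>If \<open>k = 0\<close>, then \<open>N\<close> is not in the support of the sum;
    the added factor is \<open>B 0 N = 1\<close>.\<close>
  have "(\<Prod>l\<in>Poly_Mapping.keys (I + Poly_Mapping.single N k). B (Poly_Mapping.lookup (I + Poly_Mapping.single N k) l) l) =
      (\<Prod>l\<in>insert N (Poly_Mapping.keys I). B (Poly_Mapping.lookup (I + Poly_Mapping.single N k) l) l)"
    using keys_add[of I "Poly_Mapping.single N k"]
    by (intro prod.mono_neutral_left) (auto simp: in_keys_iff assms(1) split: if_splits)
  also have "\<dots> = B k N * (\<Prod>l\<in>Poly_Mapping.keys I. B (Poly_Mapping.lookup I l) l)"
    using N by (auto simp: lookup_add lookup_single when_def assms(2) intro!: arg_cong2[where f = "(*)"] prod.cong)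
  finally show ?thesis .
qed

text \<open>Quantization is not multiplicative in general. This product is respected because entry
  \<open>N\<close> is still free in every monomial underlying \<open>f\<close>: the new factor
  merely fills it, and \<open>k \<le> N\<close> keeps the sequence standard.\<close>

lemma quantizes_mult:
  assumes "quantizes N f F" "k \<le> N"
  shows "quantizes (Suc N) (e_poly k N * f) (E_poly k N * F)"
  using assms(1)
proof (induction rule: quantizes.induct)
  case (monomial I)
  define J where "J = I + Poly_Mapping.single N k"
  have N: "Poly_Mapping.lookup I N = 0" using monomial by (auto simp: in_keys_iff subset_iff)
  have "e_monomial J = e_poly k N * e_monomial I" "E_monomial J = E_poly k N * E_monomial I"
    unfolding e_monomial_def E_monomial_def J_def
    by (rule prod_keys_add_single; simp add: N)+
  moreover have "J \<in> std_seqs"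
    using monomial(1) N assms(2) by (auto simp: std_seqs_def J_def lookup_add lookup_single when_def)
  moreover have "Poly_Mapping.keys J \<subseteq> {..<Suc N}"
    using keys_add[of I "Poly_Mapping.single N k"] monomial(2)
    by (auto simp: J_def split: if_splits)
  ultimately show ?case using quantizes.monomial[of J "Suc N"] by simp
qed (auto simp: right_diff_distrib intro: quantizes.intros)

text \<open>A derivation of \<open>quantizes\<close> yields one coefficient family expanding
  \<open>f\<close> in the \<open>e_monomial\<close> and \<open>F\<close> in the
  \<open>E_monomial\<close>; by independence this family is \<open>e_coeffs f\<close>.\<close>

lemma quantizes_imp_quantization_eq:
  assumes "quantizes N f F"
  shows "quantization f = F"
proof -
  from assms have "\<exists>c. Poly_Mapping.keys c \<subseteq> std_seqs \<and> f = linear_ext e_monomial c \<and> F = linear_ext E_monomial c"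
  proof (induction rule: quantizes.induct)
    case zero
    show ?case by (rule exI[of _ 0]) simp
  next
    case (monomial I)
    then show ?case by (intro exI[of _ "frag_of I"]) simp
  next
    case (diff f F g G)
    then obtain c d where "Poly_Mapping.keys c \<subseteq> std_seqs" "f = linear_ext e_monomial c" "F = linear_ext E_monomial c"
      "Poly_Mapping.keys d \<subseteq> std_seqs" "g = linear_ext e_monomial d" "G = linear_ext E_monomial d" by auto
    then show ?case
      using keys_diff[of c d] by (intro exI[of _ "c - d"]) (auto simp: linear_ext_diff)
  qed
  then obtain c where c: "Poly_Mapping.keys c \<subseteq> std_seqs" "f = linear_ext e_monomial c" "F = linear_ext E_monomial c"
    by blast
  have "e_coeffs f = c"
    unfolding e_coeffs_def linear_ext_def[symmetric]
  proof (rule the_equality)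
    fix d assume d: "Poly_Mapping.keys d \<subseteq> std_seqs \<and> f = linear_ext e_monomial d"
    then have "linear_ext e_monomial (d - c) = 0"
      using c(2) by (simp add: linear_ext_diff)
    moreover have "Poly_Mapping.keys (d - c) \<subseteq> std_seqs"
      using keys_diff[of d c] c(1) d by blast
    ultimately have "d - c = 0"
      by (intro e_monomial_independent)
    then show "d = c" by simp
  qed (use c in simp)
  then show ?thesis
    by (simp add: quantization_def linear_ext_def[symmetric] c(3))
qed

text \<open>The factor \<open>e_poly k (j + i)\<close> has a larger upper index than all the factors occurring in
  \<open>h_poly (Suc i - k) j\<close>, so that the recurrence produces standard monomials only.\<close>

lemma quantizes_h_poly:
  assumes "j \<ge> 1"
  shows "quantizes (j + i) (h_poly i j) (H_poly i j)"
    and "i \<ge> 1 \<Longrightarrow> (\<Sum>k\<le>i. (- 1) ^ k * E_poly k (j + i - 1) * H_poly (i - k) j) = 0"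
proof -
  have "quantizes (j + i) (h_poly i j) (H_poly i j) \<and>
    (i \<ge> 1 \<longrightarrow> (\<Sum>k\<le>i. (- 1) ^ k * E_poly k (j + i - 1) * H_poly (i - k) j) = 0)"
  proof (induction i rule: less_induct)
    case (less i)
    show ?case
    proof (cases i)
      case 0
      then show ?thesis
        using quantizes_one[of j] quantizes_imp_quantization_eq[OF quantizes_one]
        by (simp add: H_poly_def)
    next
      case (Suc i')
      let ?N = "j + i'"
      define F where "F = - (\<Sum>k<i. (- 1) ^ Suc k * (E_poly (Suc k) ?N * H_poly (i - Suc k) j))"
      \<comment> \<open>The vanishing identity with \<open>d = i'\<close>, solved for its
        \<open>k = 0\<close> term.\<close>
      have h: "h_poly i j = - (\<Sum>k<i. (- 1) ^ Suc k * (e_poly (Suc k) ?N * h_poly (i - Suc k) j))"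
        using sum_e_poly_h_poly_eq_0[of i' i j] Suc
        by (simp add: sum.atMost_Suc_shift lessThan_Suc_atMost eq_neg_iff_add_eq_0 mult.assoc del: sum.atMost_Suc)
      have qk: "quantizes (Suc ?N) ((- 1) ^ Suc k * (e_poly (Suc k) ?N * h_poly (i - Suc k) j))
          ((- 1) ^ Suc k * (E_poly (Suc k) ?N * H_poly (i - Suc k) j))" if "k < i" for k
      proof -
        \<comment> \<open>All entries lie below \<open>j + (i - Suc k) \<le> ?N\<close>, so entry
          \<open>?N\<close> is free; \<open>j \<ge> 1\<close> gives
          \<open>Suc k \<le> i \<le> ?N\<close>, as standardness demands.\<close>
        have "quantizes ?N (h_poly (i - Suc k) j) (H_poly (i - Suc k) j)"
          using less.IH[of "i - Suc k"] that Suc quantizes_mono[of "j + (i - Suc k)" _ _ ?N] by auto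
        then have "quantizes (Suc ?N) (e_poly (Suc k) ?N * h_poly (i - Suc k) j)
            (E_poly (Suc k) ?N * H_poly (i - Suc k) j)"
          using that Suc assms by (intro quantizes_mult) auto
        then show ?thesis
          by (cases "even k") (auto intro: quantizes_uminus)
      qed
      have N: "j + i = Suc ?N" using Suc by simp
      have q: "quantizes (j + i) (h_poly i j) F"
        unfolding F_def h N by (intro quantizes_uminus quantizes_sum qk) simp
      then have H: "H_poly i j = F"
        unfolding H_poly_def by (rule quantizes_imp_quantization_eq)
      have "(\<Sum>k\<le>i. (- 1) ^ k * E_poly k (j + i - 1) * H_poly (i - k) j) = H_poly i j - F"
        using Suc by (simp add: F_def sum.atMost_Suc_shift lessThan_Suc_atMost mult.assoc del: sum.atMost_Suc)
      then show ?thesis using q H by simp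
    qed
  qed
  then show "quantizes (j + i) (h_poly i j) (H_poly i j)"
    and "i \<ge> 1 \<Longrightarrow> (\<Sum>k\<le>i. (- 1) ^ k * E_poly k (j + i - 1) * H_poly (i - k) j) = 0"
    by auto
qed

lemmas sum_E_poly_H_poly_eq_0 = quantizes_h_poly(2)

lemma H_poly_0: "H_poly 0 j = 1"
  using quantizes_imp_quantization_eq[OF quantizes_one] by (simp add: H_poly_def)

text \<open>The recurrence for H_i^{(j)} uses E with upper index \<open>j + i - 1\<close>, which
  must be at most \<open>n\<close>; this explains the bound \<open>Suc n\<close>.\<close>

lemma H_poly_homogeneous:
  assumes "j \<ge> 1" "j + i \<le> Suc n"
  shows "H_poly i j \<in> homogeneous_part (XQ_vars n) xq_deg (2 * i)"
  using assms(2)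
proof (induction i rule: less_induct)
  case (less i)
  show ?case
  proof (cases i)
    case 0
    then show ?thesis by (simp add: H_poly_0 homogeneous_part_one)
  next
    case (Suc i')
    have "H_poly i j = - (\<Sum>k\<le>i'. (- 1) ^ Suc k * E_poly (Suc k) (j + i') * H_poly (i' - k) j)"
      using sum_E_poly_H_poly_eq_0[OF assms(1), of i] Suc
      by (simp add: sum.atMost_Suc_shift eq_neg_iff_add_eq_0 del: sum.atMost_Suc)
    moreover have "(- 1) ^ Suc k * E_poly (Suc k) (j + i') * H_poly (i' - k) j
        \<in> homogeneous_part (XQ_vars n) xq_deg (2 * i)" if "k \<le> i'" for k
    proof -
      have "0 + 2 * Suc k + 2 * (i' - k) = 2 * i" using that Suc by simp
      then show ?thesis
        using homogeneous_part_mult[OF homogeneous_part_mult[OF homogeneous_part_minus_one_power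
          E_poly_homogeneous[of "j + i'" n "Suc k"]] less.IH[of "i' - k"], of "Suc k"]
          that less.prems Suc by simp
    qed
    ultimately show ?thesis
      by (simp only:) (intro homogeneous_part_uminus homogeneous_part_sum, simp only: atMost_iff)
  qed
qed

section \<open>Graded rings\<close>

lemma poly_over_simps [simp]:
  "x \<otimes>\<^bsub>poly_over V\<^esub> y = x * y" "\<one>\<^bsub>poly_over V\<^esub> = 1"
  "x \<oplus>\<^bsub>poly_over V\<^esub> y = x + y" "\<zero>\<^bsub>poly_over V\<^esub> = 0"
  by (simp_all add: poly_over_def)

lemma poly_over_zero_closed: "0 \<in> carrier (poly_over V)"
  and poly_over_one_closed: "1 \<in> carrier (poly_over V)"
  unfolding carrier_poly_over_eq_homogeneous_part
  by (rule homogeneous_part_zero homogeneous_part_one)+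

lemma poly_over_add_closed:
  "p \<in> carrier (poly_over V) \<Longrightarrow> q \<in> carrier (poly_over V) \<Longrightarrow> p + q \<in> carrier (poly_over V)"
  unfolding carrier_poly_over_eq_homogeneous_part by (rule homogeneous_part_add)

lemma poly_over_uminus_closed: "p \<in> carrier (poly_over V) \<Longrightarrow> - p \<in> carrier (poly_over V)"
  unfolding carrier_poly_over_eq_homogeneous_part by (rule homogeneous_part_uminus)

lemma poly_over_mult_closed:
  "p \<in> carrier (poly_over V) \<Longrightarrow> q \<in> carrier (poly_over V) \<Longrightarrow> p * q \<in> carrier (poly_over V)"
  unfolding carrier_poly_over_eq_homogeneous_part
  using homogeneous_part_mult[of p V "\<lambda>_. 0" 0 q 0] by simp

lemmas poly_over_closed = poly_over_zero_closed poly_over_one_closed poly_over_add_closed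
  poly_over_uminus_closed poly_over_mult_closed

lemma cring_poly_over: "cring (poly_over V)"
proof (rule cringI)
  show "abelian_group (poly_over V)"
    by (rule abelian_groupI)
      (auto simp: algebra_simps poly_over_closed intro!: bexI[of _ "- _"])
  show "Group.comm_monoid (poly_over V)"
    by (rule comm_monoidI) (auto simp: algebra_simps poly_over_closed)
qed (auto simp: algebra_simps)

lemma a_inv_poly_over [simp]:
  assumes "p \<in> carrier (poly_over V)"
  shows "\<ominus>\<^bsub>poly_over V\<^esub> p = - p"
proof -
  interpret cring "poly_over V" by (rule cring_poly_over)
  show ?thesis
    using minus_equality[of "- p" p] assms by (simp add: poly_over_closed)
qed

lemma finsum_poly_over:
  assumes "finite A" "\<And>a. a \<in> A \<Longrightarrow> f a \<in> carrier (poly_over V)"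
  shows "finsum (poly_over V) f A = sum f A"
proof -
  interpret cring "poly_over V" by (rule cring_poly_over)
  show ?thesis
    using assms by (induction A rule: finite_induct) (auto simp: Pi_def)
qed

text \<open>Gives uniqueness of decompositions: every coefficient of every component is dictated by
  \<open>p\<close>.\<close>

lemma lookup_homogeneous_decomposition:
  assumes "\<And>d. f d \<in> homogeneous_part V w d" "finite {d. f d \<noteq> 0}"
    and "p = (\<Sum>d | f d \<noteq> 0. f d)"
  shows "Poly_Mapping.lookup (f d) m = (if weighted_deg w m = d then Poly_Mapping.lookup p m else 0)"
proof -
  have 0: "Poly_Mapping.lookup (f e) m = 0" if "e \<noteq> weighted_deg w m" for e
    using assms(1)[of e] that by (auto simp: homogeneous_part_iff in_keys_iff)
  have "Poly_Mapping.lookup p m = (\<Sum>e | f e \<noteq> 0. Poly_Mapping.lookup (f e) m)"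
    unfolding assms(3) by (rule lookup_sum)
  also have "\<dots> = (\<Sum>e | f e \<noteq> 0. if e = weighted_deg w m then Poly_Mapping.lookup (f e) m else 0)"
    by (intro sum.cong) (auto simp: 0)
  also have "\<dots> = Poly_Mapping.lookup (f (weighted_deg w m)) m"
    using assms(2) by (auto simp: sum.delta)
  finally show ?thesis
    using 0 by auto
qed

lemma graded_ring_poly_over: "graded_ring (poly_over V) (homogeneous_part V w)"
proof -
  interpret cring "poly_over V" by (rule cring_poly_over)
  show ?thesis
  proof (intro graded_ring.intro graded_ring_axioms.intro ring_axioms)
    fix d
    show "additive_subgroup (homogeneous_part V w d) (poly_over V)"
    proof (rule additive_subgroupI, rule add.subgroupI)
      fix p assume p: "p \<in> homogeneous_part V w d"
      then have "p \<in> carrier (poly_over V)" by (simp add: homogeneous_part_def)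
      then show "\<ominus>\<^bsub>poly_over V\<^esub> p \<in> homogeneous_part V w d"
        using p by (simp add: homogeneous_part_uminus)
    next
      show "homogeneous_part V w d \<noteq> {}" using homogeneous_part_zero by blast
    qed (use homogeneous_part_carrier in \<open>auto simp: homogeneous_part_add\<close>)
  next
    fix p q d e assume "p \<in> homogeneous_part V w d" "q \<in> homogeneous_part V w e"
    then show "p \<otimes>\<^bsub>poly_over V\<^esub> q \<in> homogeneous_part V w (d + e)"
      by (simp add: homogeneous_part_mult)
  next
    fix p assume p: "p \<in> carrier (poly_over V)"
    define M where "M d = {m \<in> Poly_Mapping.keys p. weighted_deg w m = d}" for d
    define f where "f d = (\<Sum>m\<in>M d. Poly_Mapping.single m (Poly_Mapping.lookup p m))" for d
    have hom: "f d \<in> homogeneous_part V w d" for d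
      unfolding f_def
    proof (rule homogeneous_part_sum)
      fix m assume "m \<in> M d"
      then show "Poly_Mapping.single m (Poly_Mapping.lookup p m) \<in> homogeneous_part V w d"
        using p by (auto simp: M_def homogeneous_part_iff carrier_poly_over_iff)
    qed
    have sub: "{d. f d \<noteq> 0} \<subseteq> weighted_deg w ` Poly_Mapping.keys p"
    proof
      fix d assume "d \<in> {d. f d \<noteq> 0}"
      then have "M d \<noteq> {}" by (auto simp: f_def)
      then show "d \<in> weighted_deg w ` Poly_Mapping.keys p" by (auto simp: M_def)
    qed
    then have fin: "finite {d. f d \<noteq> 0}"
      by (rule finite_subset) simp
    have "(\<Sum>d | f d \<noteq> 0. f d) = (\<Sum>d\<in>weighted_deg w ` Poly_Mapping.keys p. f d)"
      by (rule sum.mono_neutral_left) (use sub in auto)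
    also have "\<dots> = (\<Sum>m\<in>Poly_Mapping.keys p. Poly_Mapping.single m (Poly_Mapping.lookup p m))"
      unfolding f_def M_def by (rule sum.image_gen[symmetric]) simp
    also have "\<dots> = p"
      by (rule poly_mapping_eqI) (simp add: lookup_sum lookup_single when_def sum.delta in_keys_iff)
    finally have sum: "(\<Sum>d | f d \<noteq> 0. f d) = p" .
    have finsum: "(\<Oplus>\<^bsub>poly_over V\<^esub>d\<in>{d. g d \<noteq> 0}. g d) = (\<Sum>d | g d \<noteq> 0. g d)"
      if "\<forall>d. g d \<in> homogeneous_part V w d" "finite {d. g d \<noteq> 0}" for g
      by (rule finsum_poly_over) (use that homogeneous_part_carrier[of V w] in blast)+
    show "\<exists>!f. (\<forall>d. f d \<in> homogeneous_part V w d) \<and> finite {d. f d \<noteq> \<zero>\<^bsub>poly_over V\<^esub>} \<and>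
        p = (\<Oplus>\<^bsub>poly_over V\<^esub>d\<in>{d. f d \<noteq> \<zero>\<^bsub>poly_over V\<^esub>}. f d)"
    proof (rule ex1I[of _ f])
      show "(\<forall>d. f d \<in> homogeneous_part V w d) \<and> finite {d. f d \<noteq> \<zero>\<^bsub>poly_over V\<^esub>} \<and>
        p = (\<Oplus>\<^bsub>poly_over V\<^esub>d\<in>{d. f d \<noteq> \<zero>\<^bsub>poly_over V\<^esub>}. f d)"
        using hom fin sum finsum[of f] by simp
    next
      fix g assume g: "(\<forall>d. g d \<in> homogeneous_part V w d) \<and> finite {d. g d \<noteq> \<zero>\<^bsub>poly_over V\<^esub>} \<and>
        p = (\<Oplus>\<^bsub>poly_over V\<^esub>d\<in>{d. g d \<noteq> \<zero>\<^bsub>poly_over V\<^esub>}. g d)"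
      then have "p = (\<Sum>d | g d \<noteq> 0. g d)"
        using finsum[of g] by simp
      then show "g = f"
        using lookup_homogeneous_decomposition[of g V w p] g
          lookup_homogeneous_decomposition[of f V w p] hom fin sum
        by (intro ext poly_mapping_eqI) simp
    qed
  qed
qed

text \<open>Provides the grading of \<open>Q_ring n\<close> by transport along \<open>phi n\<close>,
  after its graded pieces are identified as images.\<close>

lemma graded_ring_iso_image:
  assumes R: "graded_ring R A" and S: "ring S" and f: "f \<in> ring_iso R S"
  shows "graded_ring S (\<lambda>d. f ` A d)"
proof -
  interpret R: graded_ring R A by fact
  interpret S: ring S by fact
  have hom: "f \<in> ring_hom R S" and bij: "bij_betw f (carrier R) (carrier S)"
    using f by (auto simp: ring_iso_def)
  interpret f: ring_hom_ring R S f
    by (rule ring_hom_ringI2[OF R.ring_axioms S hom])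
  have A: "A d \<subseteq> carrier R" for d
    using R.component_subgroup[of d] by (rule additive_subgroup.a_subset)
  have zero: "f x = \<zero>\<^bsub>S\<^esub> \<longleftrightarrow> x = \<zero>\<^bsub>R\<^esub>" if "x \<in> carrier R" for x
    using that bij f.hom_zero R.zero_closed by (metis bij_betw_inv_into_left)
  \<comment> \<open>Injectivity of \<open>f\<close> keeps the support of a family unchanged, so that
    the two finite sums run over the same degrees.\<close>
  have supp: "{d. f (h d) \<noteq> \<zero>\<^bsub>S\<^esub>} = {d. h d \<noteq> \<zero>\<^bsub>R\<^esub>}" if "\<forall>d. h d \<in> A d" for h
    using that A zero by blast
  have finsum: "f (\<Oplus>\<^bsub>R\<^esub>d\<in>{d. h d \<noteq> \<zero>\<^bsub>R\<^esub>}. h d) =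
      (\<Oplus>\<^bsub>S\<^esub>d\<in>{d. f (h d) \<noteq> \<zero>\<^bsub>S\<^esub>}. f (h d))" if "\<forall>d. h d \<in> A d" for h
  proof -
    have "h d \<in> carrier R" for d using that A by auto
    then have "f (\<Oplus>\<^bsub>R\<^esub>d\<in>D. h d) = (\<Oplus>\<^bsub>S\<^esub>d\<in>D. f (h d))" for D
      by (induction D rule: infinite_finite_induct) auto
    then show ?thesis
      by (simp only: supp[OF that])
  qed
  show ?thesis
  proof (intro graded_ring.intro graded_ring_axioms.intro S)
    fix d
    have "subgroup (f ` A d) (add_monoid S)"
      using R.component_subgroup[of d]
      by (intro group_hom.subgroup_img_is_subgroup[OF f.a_group_hom]) (simp add: additive_subgroup_def)
    then show "additive_subgroup (f ` A d) S"
      by (rule additive_subgroupI)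
  next
    fix x y d e assume "x \<in> f ` A d" "y \<in> f ` A e"
    then obtain a b where ab: "a \<in> A d" "b \<in> A e" "x = f a" "y = f b" by auto
    then have "x \<otimes>\<^bsub>S\<^esub> y = f (a \<otimes>\<^bsub>R\<^esub> b)"
      using A by (metis f.hom_mult subsetD)
    then show "x \<otimes>\<^bsub>S\<^esub> y \<in> f ` A (d + e)"
      using R.component_mult[OF ab(1,2)] by simp
  next
    fix y assume "y \<in> carrier S"
    then obtain x where x: "x \<in> carrier R" "y = f x"
      using bij by (metis bij_betw_imp_surj_on imageE)
    from R.direct_sum[OF x(1)] obtain g where
      g: "\<forall>d. g d \<in> A d" "finite {d. g d \<noteq> \<zero>\<^bsub>R\<^esub>}" "x = (\<Oplus>\<^bsub>R\<^esub>d\<in>{d. g d \<noteq> \<zero>\<^bsub>R\<^esub>}. g d)"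
      and uniq: "\<And>h. \<forall>d. h d \<in> A d \<Longrightarrow> finite {d. h d \<noteq> \<zero>\<^bsub>R\<^esub>} \<Longrightarrow>
        x = (\<Oplus>\<^bsub>R\<^esub>d\<in>{d. h d \<noteq> \<zero>\<^bsub>R\<^esub>}. h d) \<Longrightarrow> h = g"
      by blast
    show "\<exists>!g. (\<forall>d. g d \<in> f ` A d) \<and> finite {d. g d \<noteq> \<zero>\<^bsub>S\<^esub>} \<and>
        y = (\<Oplus>\<^bsub>S\<^esub>d\<in>{d. g d \<noteq> \<zero>\<^bsub>S\<^esub>}. g d)"
    proof (rule ex1I[of _ "\<lambda>d. f (g d)"])
      show "(\<forall>d. f (g d) \<in> f ` A d) \<and> finite {d. f (g d) \<noteq> \<zero>\<^bsub>S\<^esub>} \<and>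
          y = (\<Oplus>\<^bsub>S\<^esub>d\<in>{d. f (g d) \<noteq> \<zero>\<^bsub>S\<^esub>}. f (g d))"
        using g x(2) finsum[OF g(1)] supp[OF g(1)] by auto
    next
      fix k assume k: "(\<forall>d. k d \<in> f ` A d) \<and> finite {d. k d \<noteq> \<zero>\<^bsub>S\<^esub>} \<and>
          y = (\<Oplus>\<^bsub>S\<^esub>d\<in>{d. k d \<noteq> \<zero>\<^bsub>S\<^esub>}. k d)"
      then have "\<forall>d. \<exists>a. a \<in> A d \<and> k d = f a" by auto
      then obtain h where h: "\<forall>d. h d \<in> A d" "\<And>d. k d = f (h d)" by metis
      have kh: "k = (\<lambda>d. f (h d))" using h(2) by auto
      have "f x = f (\<Oplus>\<^bsub>R\<^esub>d\<in>{d. h d \<noteq> \<zero>\<^bsub>R\<^esub>}. h d)"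
        unfolding finsum[OF h(1)] using k x(2) unfolding kh by simp
      moreover have "(\<Oplus>\<^bsub>R\<^esub>d\<in>{d. h d \<noteq> \<zero>\<^bsub>R\<^esub>}. h d) \<in> carrier R"
        using h(1) A by (intro R.finsum_closed) auto
      ultimately have "x = (\<Oplus>\<^bsub>R\<^esub>d\<in>{d. h d \<noteq> \<zero>\<^bsub>R\<^esub>}. h d)"
        using x(1) bij by (metis bij_betw_inv_into_left)
      moreover have "finite {d. h d \<noteq> \<zero>\<^bsub>R\<^esub>}"
        using k unfolding kh supp[OF h(1)] by simp
      ultimately have "h = g"
        using uniq h(1) by blast
      then show "k = (\<lambda>d. f (g d))" using kh by simp
    qed
  qed
qed

section \<open>Specializing the characteristic polynomials\<close>

text \<open>Read row \<open>i\<close> of \<open>a\<close> as a monic polynomial of degree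
  \<open>i\<close> and \<open>b\<close> as a polynomial of degree below \<open>j\<close>: leading
  terms are removed from the top.\<close>

lemma unitriangular_solve:
  fixes a :: "nat \<Rightarrow> nat \<Rightarrow> 'a::comm_ring_1"
  assumes "\<And>j. a j j = 1" "\<And>j k. j < k \<Longrightarrow> a j k = 0" "\<And>k. j \<le> k \<Longrightarrow> b k = 0"
  shows "\<exists>y. \<forall>k. b k = (\<Sum>i<j. y i * a i k)"
  using assms(3)
proof (induction j arbitrary: b)
  case 0
  then show ?case by simp
next
  case (Suc j)
  define b' where "b' k = b k - b j * a j k" for k
  have "b' k = 0" if "j \<le> k" for k
    using that Suc.prems[of k] assms(1,2)[of j] by (cases "k = j") (auto simp: b'_def)
  then obtain y where y: "\<And>k. b' k = (\<Sum>i<j. y i * a i k)"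
    using Suc.IH[of b'] by blast
  have "b k = (\<Sum>i<Suc j. (y(j := b j)) i * a i k)" for k
    using y[of k] by (simp add: b'_def algebra_simps)
  then show ?case by blast
qed

text \<open>The recurrence is run backwards. For monic rows a_j of degree j, the leading terms of t
  a_j - a_{j+1} cancel, so this difference is a combination of a_0, ..., a_j. Its coefficients are
  the values to be given to the \<open>y_poly\<close>.\<close>

lemma P_poly_specialization:
  fixes a :: "nat \<Rightarrow> nat \<Rightarrow> 'a::comm_ring_1"
  assumes a: "\<And>j. a j j = 1" "\<And>j k. j < k \<Longrightarrow> a j k = 0"
  shows "\<exists>f. \<forall>j k. ipoly_eval f (poly.coeff (P_poly j) k) = a j k"
proof -
  have "\<exists>y. \<forall>k. (case k of 0 \<Rightarrow> 0 | Suc k' \<Rightarrow> a j k') - a (Suc j) k = (\<Sum>i<Suc j. y i * a i k)" for j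
  proof (rule unitriangular_solve[OF a])
    fix k assume "Suc j \<le> k"
    then show "(case k of 0 \<Rightarrow> 0 | Suc k' \<Rightarrow> a j k') - a (Suc j) k = 0"
      using a by (cases "k = Suc j") (auto split: nat.split)
  qed
  then obtain y where
    y: "\<And>j k. (case k of 0 \<Rightarrow> 0 | Suc k' \<Rightarrow> a j k') - a (Suc j) k = (\<Sum>i<Suc j. y j i * a i k)"
    by metis
  \<comment> \<open>The sign cancels the one in \<open>y_poly\<close>; the shifts by one arise
    because \<open>y\<close> is indexed from 0.\<close>
  define f where "f v = (case v of X j \<Rightarrow> y (j - 1) (j - 1) | Q i j \<Rightarrow> (- 1) ^ (j - i) * y (j - 1) (i - 1))" for v
  have f_y: "ipoly_eval f (y_poly (Suc i) (Suc j)) = y j i" for i j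
    by (simp add: y_poly_def f_def ipoly_eval.hom_mult ipoly_eval.hom_power ipoly_eval_uminus
      mult.assoc[symmetric] power_add[symmetric])
  have "ipoly_eval f (poly.coeff (P_poly j) k) = a j k" for j k
  proof (induction j arbitrary: k rule: less_induct)
    case (less j)
    show ?case
    proof (cases j)
      case 0
      then show ?thesis using a by (cases k) (auto simp: P_poly_0)
    next
      case (Suc i)
      have "ipoly_eval f (case k of 0 \<Rightarrow> 0 | Suc k' \<Rightarrow> poly.coeff (P_poly i) k') =
          (case k of 0 \<Rightarrow> 0 | Suc k' \<Rightarrow> a i k')"
        using less.IH Suc by (simp split: nat.split)
      then show ?thesis
        using y[of i k] less.IH Suc
        by (simp add: coeff_P_poly_Suc ipoly_eval_diff ipoly_eval.hom_sum ipoly_eval.hom_mult f_y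
            lessThan_Suc_atMost algebra_simps del: sum.atMost_Suc sum.lessThan_Suc)
    qed
  qed
  then show ?thesis by blast
qed

text \<open>The inverse of the unitriangular matrix with entries \<open>var (i, j)\<close> below the diagonal, where
  rows and columns of the inverse are indexed from 0.\<close>

function inverse_entry :: "nat \<Rightarrow> nat \<Rightarrow> (nat \<times> nat) ipoly" where
  "inverse_entry j k = (if j = k then 1 else if j < k then 0
     else - (\<Sum>l\<in>{k<..j}. inverse_entry j l * var (Suc l, Suc k)))"
  by pat_completeness auto
termination by (relation "measure (\<lambda>(j, k). j - k)") auto

declare inverse_entry.simps [simp del]

text \<open>The substitution is a left inverse of \<open>phi n\<close> on representatives: the first
  property lets it descend to the quotient, the second recovers the variables.\<close>

lemma inverse_specialization:
  obtains f :: "xq \<Rightarrow> (nat \<times> nat) ipoly"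
  where "\<And>i. 1 \<le> i \<Longrightarrow> i \<le> n \<Longrightarrow> ipoly_eval f (E_poly i n) = 0"
    and "\<And>i j. 1 \<le> j \<Longrightarrow> j < i \<Longrightarrow> i \<le> n \<Longrightarrow> ipoly_eval f (H_poly (i - j) j) = var (i, j)"
proof -
  \<comment> \<open>Row \<open>n\<close> is that of t^n, so every E_i^{(n)} with i >= 1 goes to 0.
    In any other row \<open>j\<close>, (-1)^i E_i^{(j)} goes to entry \<open>j - i\<close> of the
    inverse matrix.\<close>
  define a where "a j k = (if j = n then (if k = n then 1 else 0) else inverse_entry j k)" for j k
  have "\<exists>f. \<forall>j k. ipoly_eval f (poly.coeff (P_poly j) k) = a j k"
    by (rule P_poly_specialization) (auto simp: a_def inverse_entry.simps)
  then obtain f where f: "\<And>j k. ipoly_eval f (poly.coeff (P_poly j) k) = a j k" by auto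
  have f_E: "ipoly_eval f (E_poly i j) = (- 1) ^ i * a j (j - i)" if "i \<le> j" for i j
    using that by (simp add: E_poly_def ipoly_eval.hom_mult ipoly_eval.hom_power ipoly_eval_uminus f)
  have f_H: "ipoly_eval f (H_poly i j) = (if i = 0 then 1 else var (j + i, j))"
    if "1 \<le> j" "j + i \<le> n" for i j
    using that(2)
  proof (induction i rule: less_induct)
    case (less i)
    show ?case
    proof (cases i)
      case 0
      then show ?thesis by (simp add: H_poly_0)
    next
      case (Suc i')
      define N where "N = j + i - 1"
      \<comment> \<open>\<open>j + i \<le> n\<close> keeps \<open>N\<close> below \<open>n\<close>,
        away from the exceptional row. Column \<open>N - i = j - 1\<close> is column
        \<open>j\<close> of the matrix of variables, counted from 0.\<close>
      have N: "N \<noteq> n" "j - 1 < N" "N - i = j - 1" "i \<le> N" using that Suc less.prems by (auto simp: N_def)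
      have "0 = ipoly_eval f (\<Sum>k\<le>i. (- 1) ^ k * E_poly k N * H_poly (i - k) j)"
        using sum_E_poly_H_poly_eq_0[OF that(1), of i] Suc by (simp add: N_def)
      also have "\<dots> = (\<Sum>k\<le>i. a N (N - k) * ipoly_eval f (H_poly (i - k) j))"
        unfolding ipoly_eval.hom_sum
      proof (rule sum.cong[OF refl])
        fix k assume "k \<in> {..i}"
        then show "ipoly_eval f ((- 1) ^ k * E_poly k N * H_poly (i - k) j) =
            a N (N - k) * ipoly_eval f (H_poly (i - k) j)"
          using N by (simp add: ipoly_eval.hom_mult ipoly_eval.hom_power ipoly_eval_uminus f_E
            mult.assoc[symmetric] power_add[symmetric])
      qed
      also have "\<dots> = (\<Sum>k<i. a N (N - k) * ipoly_eval f (H_poly (i - k) j)) + a N (j - 1)"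
        using N by (simp add: lessThan_Suc_atMost[symmetric] H_poly_0)
      also have "a N (j - 1) = - (\<Sum>l\<in>{j - 1<..N}. a N l * var (Suc l, j))"
        using N that(1) by (subst a_def, subst inverse_entry.simps) (simp add: a_def)
      also have "(\<Sum>l\<in>{j - 1<..N}. a N l * var (Suc l, j)) = (\<Sum>k<i. a N (N - k) * var (j + i - k, j))"
        using that(1) Suc
        by (intro sum.reindex_bij_witness[of _ "\<lambda>k. N - k" "\<lambda>l. N - l"]) (auto simp: N_def)
      \<comment> \<open>By induction the recurrence for H and the one defining the inverse agree
        term by term for positive \<open>k\<close>. The \<open>k = 0\<close> terms have coefficient
        \<open>a N N = 1\<close>, which forces the image of H_i^{(j)} to be the variable.\<close>
      also have "(\<Sum>k<i. a N (N - k) * ipoly_eval f (H_poly (i - k) j)) =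
          ipoly_eval f (H_poly i j) + (\<Sum>k<i'. a N (N - Suc k) * var (j + i - Suc k, j))"
      proof -
        have "ipoly_eval f (H_poly (i - Suc k) j) = var (j + i - Suc k, j)" if "k < i'" for k
          using less.IH[of "i - Suc k"] less.prems Suc that by simp
        moreover have "a N N = 1" by (simp add: a_def inverse_entry.simps)
        ultimately show ?thesis
          unfolding Suc sum.lessThan_Suc_shift by simp
      qed
      also have "(\<Sum>k<i. a N (N - k) * var (j + i - k, j)) =
          var (j + i, j) + (\<Sum>k<i'. a N (N - Suc k) * var (j + i - Suc k, j))"
      proof -
        have "a N N = 1" by (simp add: a_def inverse_entry.simps)
        then show ?thesis unfolding Suc sum.lessThan_Suc_shift by simp
      qed
      finally show ?thesis using Suc by simp
    qed
  qed
  show ?thesis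
  proof
    show "ipoly_eval f (E_poly i n) = 0" if "1 \<le> i" "i \<le> n" for i
      using that by (simp add: f_E a_def)
    show "ipoly_eval f (H_poly (i - j) j) = var (i, j)" if "1 \<le> j" "j < i" "i \<le> n" for i j
      using f_H[of j "i - j"] that by simp
  qed
qed

section \<open>The isomorphism\<close>

definition H_var :: "nat \<times> nat \<Rightarrow> xq ipoly" where
  "H_var = (\<lambda>(i, j). H_poly (i - j) j)"

lemma phi_eq: "phi n p = to_Q n (ipoly_eval H_var p)"
  by (simp add: phi_def substitute_eq_ipoly_eval H_var_def)

lemma H_var_homogeneous:
  assumes "v \<in> Z_vars n"
  shows "H_var v \<in> homogeneous_part (XQ_vars n) xq_deg ((\<lambda>(i, j). 2 * (i - j)) v)"
  using assms H_poly_homogeneous[of "snd v" "fst v - snd v" n] by (auto simp: Z_vars_def H_var_def)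

lemma H_eval_homogeneous:
  "p \<in> ZU_grading n d \<Longrightarrow> ipoly_eval H_var p \<in> homogeneous_part (XQ_vars n) xq_deg d"
  unfolding ZU_grading_def by (erule ipoly_eval_homogeneous) (rule H_var_homogeneous)

lemma H_eval_closed:
  "p \<in> carrier (ZU_ring n) \<Longrightarrow> ipoly_eval H_var p \<in> carrier (R_ring n)"
  unfolding ZU_ring_def R_ring_def
  by (erule ipoly_eval_carrier) (use H_var_homogeneous homogeneous_part_carrier in blast)

lemma ring_R_ring: "ring (R_ring n)"
  unfolding R_ring_def by (rule cring.axioms(1)[OF cring_poly_over])

lemma E_poly_closed: "j \<le> n \<Longrightarrow> E_poly i j \<in> carrier (R_ring n)"
  unfolding R_ring_def using E_poly_homogeneous homogeneous_part_carrier by blast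

lemma E_generators_closed: "{E_poly i n | i. 1 \<le> i \<and> i \<le> n} \<subseteq> carrier (R_ring n)"
  by (auto simp: E_poly_closed)

lemma ideal_E_ideal: "ideal (E_ideal n) (R_ring n)"
  unfolding E_ideal_def by (rule ring.genideal_ideal[OF ring_R_ring E_generators_closed])

lemma ring_Q_ring: "ring (Q_ring n)"
  unfolding Q_ring_def by (rule ideal.quotient_is_ring[OF ideal_E_ideal])

lemma to_Q_hom: "to_Q n \<in> ring_hom (R_ring n) (Q_ring n)"
  unfolding to_Q_def Q_ring_def by (rule ideal.rcos_ring_hom[OF ideal_E_ideal])

lemma phi_hom: "phi n \<in> ring_hom (ZU_ring n) (Q_ring n)"
proof -
  have "ipoly_eval H_var \<in> ring_hom (ZU_ring n) (R_ring n)"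
    by (rule ring_hom_memI)
      (simp_all add: H_eval_closed, simp_all add: ZU_ring_def R_ring_def ipoly_eval_mult ipoly_eval_add)
  from ring_hom_trans[OF this to_Q_hom] show ?thesis
    by (simp add: phi_eq[abs_def] comp_def)
qed

text \<open>Restates the homomorphism laws with the operations of the polynomial type, for use with
  both \<open>to_Q\<close> and \<open>phi\<close>.\<close>

lemma poly_over_ring_hom:
  assumes h: "h \<in> ring_hom (poly_over V) S" and S: "ring S"
  shows "h 0 = \<zero>\<^bsub>S\<^esub>" and "h 1 = \<one>\<^bsub>S\<^esub>"
    and "p \<in> carrier (poly_over V) \<Longrightarrow> q \<in> carrier (poly_over V) \<Longrightarrow> h (p + q) = h p \<oplus>\<^bsub>S\<^esub> h q"
    and "p \<in> carrier (poly_over V) \<Longrightarrow> q \<in> carrier (poly_over V) \<Longrightarrow> h (p * q) = h p \<otimes>\<^bsub>S\<^esub> h q"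
    and "p \<in> carrier (poly_over V) \<Longrightarrow> h (- p) = \<ominus>\<^bsub>S\<^esub> h p"
proof -
  interpret cring "poly_over V" by (rule cring_poly_over)
  interpret h: ring_hom_ring "poly_over V" S h
    by (rule ring_hom_ringI2[OF ring_axioms S h])
  show "h 0 = \<zero>\<^bsub>S\<^esub>" "h 1 = \<one>\<^bsub>S\<^esub>"
    using h.hom_zero h.hom_one by simp_all
  show "p \<in> carrier (poly_over V) \<Longrightarrow> q \<in> carrier (poly_over V) \<Longrightarrow> h (p + q) = h p \<oplus>\<^bsub>S\<^esub> h q"
    using h.hom_add[of p q] by simp
  show "p \<in> carrier (poly_over V) \<Longrightarrow> q \<in> carrier (poly_over V) \<Longrightarrow> h (p * q) = h p \<otimes>\<^bsub>S\<^esub> h q"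
    using h.hom_mult[of p q] by simp
  show "p \<in> carrier (poly_over V) \<Longrightarrow> h (- p) = \<ominus>\<^bsub>S\<^esub> h p"
    using h.hom_a_inv[of p] by simp
qed

lemmas to_Q_simps = poly_over_ring_hom[OF to_Q_hom[unfolded R_ring_def] ring_Q_ring, folded R_ring_def]
lemmas phi_simps = poly_over_ring_hom[OF phi_hom[unfolded ZU_ring_def] ring_Q_ring, folded ZU_ring_def]

lemma to_Q_eq_zero_iff:
  assumes "p \<in> carrier (R_ring n)"
  shows "to_Q n p = \<zero>\<^bsub>Q_ring n\<^esub> \<longleftrightarrow> p \<in> E_ideal n"
proof -
  interpret ideal "E_ideal n" "R_ring n" by (rule ideal_E_ideal)
  show ?thesis
    using a_rcos_self[OF assms] a_rcos_const[of p]
    by (auto simp: to_Q_def Q_ring_def FactRing_def)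
qed

text \<open>The kernel is an ideal containing the generators. Taking \<open>poly_over UNIV\<close>
  as codomain turns the polynomial type into a ring with carrier.\<close>

lemma ipoly_eval_E_ideal:
  assumes f: "\<And>i. 1 \<le> i \<Longrightarrow> i \<le> n \<Longrightarrow> ipoly_eval f (E_poly i n) = 0" and p: "p \<in> E_ideal n"
  shows "ipoly_eval f p = (0 :: 'v ipoly)"
proof -
  let ?S = "poly_over (UNIV :: 'v set)"
  have "ring_hom_ring (R_ring n) ?S (ipoly_eval f)"
  proof (rule ring_hom_ringI2[OF ring_R_ring cring.axioms(1)[OF cring_poly_over]])
    show "ipoly_eval f \<in> ring_hom (R_ring n) ?S"
      by (rule ring_hom_memI)
        (simp_all add: carrier_poly_over_iff, simp_all add: R_ring_def ipoly_eval_mult ipoly_eval_add)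
  qed
  then have "ideal (a_kernel (R_ring n) ?S (ipoly_eval f)) (R_ring n)"
    by (rule ring_hom_ring.kernel_is_ideal)
  then have "E_ideal n \<subseteq> a_kernel (R_ring n) ?S (ipoly_eval f)"
    unfolding E_ideal_def
    by (rule ring.genideal_minimal[OF ring_R_ring]) (auto simp: a_kernel_def' E_poly_closed f)
  then show ?thesis
    using p by (auto simp: a_kernel_def')
qed

text \<open>Equality of cosets puts the value at \<open>p - q\<close> into \<open>E_ideal n\<close>.
  The specialization kills this ideal and sends each \<open>H_var v\<close> back to
  \<open>var v\<close>, so \<open>p - q = 0\<close>.\<close>

lemma inj_on_phi: "inj_on (phi n) (carrier (ZU_ring n))"
proof (rule inj_onI)
  fix p q assume pq: "p \<in> carrier (ZU_ring n)" "q \<in> carrier (ZU_ring n)" "phi n p = phi n q"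
  interpret Q: ring "Q_ring n" by (rule ring_Q_ring)
  obtain f :: "xq \<Rightarrow> (nat \<times> nat) ipoly"
    where f_E: "\<And>i. 1 \<le> i \<Longrightarrow> i \<le> n \<Longrightarrow> ipoly_eval f (E_poly i n) = 0"
      and f_H: "\<And>i j. 1 \<le> j \<Longrightarrow> j < i \<Longrightarrow> i \<le> n \<Longrightarrow> ipoly_eval f (H_poly (i - j) j) = var (i, j)"
    using inverse_specialization by blast
  have closed: "- q \<in> carrier (ZU_ring n)" "p - q \<in> carrier (ZU_ring n)"
    using pq(1,2) poly_over_add_closed[of p "Z_vars n" "- q"] by (simp_all add: ZU_ring_def poly_over_uminus_closed)
  have "phi n (p - q) = phi n p \<oplus>\<^bsub>Q_ring n\<^esub> \<ominus>\<^bsub>Q_ring n\<^esub> phi n q"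
    using phi_simps(3)[of p n "- q"] phi_simps(5)[of q n] pq closed by simp
  then have "phi n (p - q) = \<zero>\<^bsub>Q_ring n\<^esub>"
    using pq ring_hom_closed[OF phi_hom pq(2)] by (simp add: Q.r_neg)
  then have "ipoly_eval H_var (p - q) \<in> E_ideal n"
    by (simp add: phi_eq to_Q_eq_zero_iff H_eval_closed closed)
  from ipoly_eval_E_ideal[OF f_E this] have "0 = ipoly_eval (\<lambda>v. ipoly_eval f (H_var v)) (p - q)"
    by (simp add: ipoly_eval_compose)
  also have "\<dots> = ipoly_eval var (p - q)"
  proof (rule ipoly_eval_cong)
    fix m v assume "m \<in> Poly_Mapping.keys (p - q)" "v \<in> Poly_Mapping.keys m"
    then have "v \<in> Z_vars n"
      using closed(2) by (auto simp: ZU_ring_def carrier_poly_over_iff)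
    then show "ipoly_eval f (H_var v) = var v"
      by (auto simp: Z_vars_def H_var_def f_H)
  qed
  finally show "p = q" by (simp add: ipoly_eval_id)
qed

text \<open>Surjectivity is proved for this predicate. It prescribes the degree of the preimage,
  which identifies the graded pieces as well, and bundles membership in R_n, where
  \<open>to_Q\<close> is a homomorphism.\<close>

definition lifts :: "nat \<Rightarrow> nat \<Rightarrow> xq ipoly \<Rightarrow> bool" where
  "lifts n d p \<longleftrightarrow> p \<in> carrier (R_ring n) \<and> to_Q n p \<in> phi n ` ZU_grading n d"

lemma ZU_grading_closed: "p \<in> ZU_grading n d \<Longrightarrow> p \<in> carrier (ZU_ring n)"
  using homogeneous_part_carrier by (auto simp: ZU_grading_def ZU_ring_def)

lemma liftsI:
  assumes "p \<in> carrier (R_ring n)" "z \<in> ZU_grading n d" "to_Q n p = phi n z"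
  shows "lifts n d p"
  using assms by (auto simp: lifts_def)

lemma liftsE:
  assumes "lifts n d p"
  obtains z where "p \<in> carrier (R_ring n)" "z \<in> ZU_grading n d" "z \<in> carrier (ZU_ring n)"
    "to_Q n p = phi n z"
  using assms ZU_grading_closed by (auto simp: lifts_def)

lemma lifts_zero: "lifts n d 0"
  by (rule liftsI[of _ _ 0])
    (simp_all add: to_Q_simps(1) phi_simps(1) ZU_grading_def homogeneous_part_zero R_ring_def poly_over_zero_closed)

lemma lifts_one: "lifts n 0 1"
  by (rule liftsI[of _ _ 1])
    (simp_all add: to_Q_simps(2) phi_simps(2) ZU_grading_def homogeneous_part_one R_ring_def poly_over_one_closed)

lemma lifts_add:
  assumes "lifts n d p" "lifts n d q"
  shows "lifts n d (p + q)"
proof -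
  obtain z where z: "p \<in> carrier (R_ring n)" "z \<in> ZU_grading n d" "z \<in> carrier (ZU_ring n)" "to_Q n p = phi n z"
    using assms(1) by (rule liftsE)
  obtain w where w: "q \<in> carrier (R_ring n)" "w \<in> ZU_grading n d" "w \<in> carrier (ZU_ring n)" "to_Q n q = phi n w"
    using assms(2) by (rule liftsE)
  show ?thesis
  proof (rule liftsI)
    show "p + q \<in> carrier (R_ring n)"
      using z w by (simp add: R_ring_def poly_over_add_closed)
    show "z + w \<in> ZU_grading n d"
      using z w by (simp add: ZU_grading_def homogeneous_part_add)
  qed (simp add: z w to_Q_simps(3) phi_simps(3))
qed

lemma lifts_uminus:
  assumes "lifts n d p"
  shows "lifts n d (- p)"
proof -
  obtain z where z: "p \<in> carrier (R_ring n)" "z \<in> ZU_grading n d" "z \<in> carrier (ZU_ring n)" "to_Q n p = phi n z"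
    using assms by (rule liftsE)
  show ?thesis
  proof (rule liftsI)
    show "- p \<in> carrier (R_ring n)"
      using z by (simp add: R_ring_def poly_over_uminus_closed)
    show "- z \<in> ZU_grading n d"
      using z by (simp add: ZU_grading_def homogeneous_part_uminus)
  qed (simp add: z to_Q_simps(5) phi_simps(5))
qed

lemma lifts_diff: "lifts n d p \<Longrightarrow> lifts n d q \<Longrightarrow> lifts n d (p - q)"
  using lifts_add[OF _ lifts_uminus] by force

lemma lifts_sum: "(\<And>a. a \<in> A \<Longrightarrow> lifts n d (f a)) \<Longrightarrow> lifts n d (sum f A)"
  by (induction A rule: infinite_finite_induct) (auto intro: lifts_zero lifts_add)

lemma lifts_mult:
  assumes "lifts n d p" "lifts n e q"
  shows "lifts n (d + e) (p * q)"
proof -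
  obtain z where z: "p \<in> carrier (R_ring n)" "z \<in> ZU_grading n d" "z \<in> carrier (ZU_ring n)" "to_Q n p = phi n z"
    using assms(1) by (rule liftsE)
  obtain w where w: "q \<in> carrier (R_ring n)" "w \<in> ZU_grading n e" "w \<in> carrier (ZU_ring n)" "to_Q n q = phi n w"
    using assms(2) by (rule liftsE)
  show ?thesis
  proof (rule liftsI)
    show "p * q \<in> carrier (R_ring n)"
      using z w by (simp add: R_ring_def poly_over_mult_closed)
    show "z * w \<in> ZU_grading n (d + e)"
      using z w by (simp add: ZU_grading_def homogeneous_part_mult)
  qed (simp add: z w to_Q_simps(4) phi_simps(4))
qed

lemma lifts_power: "lifts n d p \<Longrightarrow> lifts n (d * k) (p ^ k)"
  by (induction k) (auto intro: lifts_one lifts_mult)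

lemma lifts_prod: "(\<And>a. a \<in> A \<Longrightarrow> lifts n (d a) (f a)) \<Longrightarrow> lifts n (sum d A) (prod f A)"
  by (induction A rule: infinite_finite_induct) (auto intro: lifts_one lifts_mult)

lemma lifts_minus_one_power: "lifts n 0 ((- 1) ^ k)"
  using lifts_power[OF lifts_uminus[OF lifts_one]] by simp

lemma lifts_H_poly:
  assumes "1 \<le> j" "j + i \<le> n"
  shows "lifts n (2 * i) (H_poly i j)"
proof (cases "i = 0")
  case True
  then show ?thesis by (simp add: H_poly_0 lifts_one)
next
  case False
  then have v: "(j + i, j) \<in> Z_vars n" using assms by (auto simp: Z_vars_def)
  have "phi n (var (j + i, j)) = to_Q n (H_poly i j)"
    by (simp add: phi_eq H_var_def)
  moreover have "var (j + i, j) \<in> ZU_grading n (2 * i)"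
    using homogeneous_part_var[OF v, of "\<lambda>(i, j). 2 * (i - j)"] by (simp add: ZU_grading_def)
  moreover have "H_poly i j \<in> carrier (R_ring n)"
    using H_poly_homogeneous[of j i n] assms homogeneous_part_carrier by (auto simp: R_ring_def)
  ultimately show ?thesis by (force simp: lifts_def)
qed

text \<open>For \<open>j = n\<close> the class is 0. For \<open>j < n\<close> the recurrence is
  solved for its term with \<open>k = i\<close>, in which H_0 = 1; the other terms contain E_k^{(j)}
  with k < i.\<close>

lemma lifts_E_poly:
  assumes "j \<le> n"
  shows "lifts n (2 * i) (E_poly i j)"
proof (induction i rule: less_induct)
  case (less i)
  consider "i = 0" | "i > j" | "1 \<le> i" "i \<le> j" "j = n" | "1 \<le> i" "i \<le> j" "j < n"
    using assms by linarith
  then show ?case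
  proof cases
    case 1
    then show ?thesis by (simp add: lifts_one)
  next
    case 2
    then show ?thesis by (simp add: E_poly_def lifts_zero)
  next
    case 3
    then have "E_poly i j \<in> E_ideal n"
      using ring.genideal_self[OF ring_R_ring E_generators_closed[of n]] by (auto simp: E_ideal_def)
    then have "to_Q n (E_poly i j) = to_Q n 0"
      using assms by (simp add: to_Q_eq_zero_iff E_poly_closed to_Q_simps(1))
    then show ?thesis
      using lifts_zero[of n "2 * i"] assms by (simp add: lifts_def E_poly_closed)
  next
    case 4
    define j' where "j' = j + 1 - i"
    \<comment> \<open>\<open>j'\<close> is chosen so that the recurrence has upper index
      \<open>j\<close>; then \<open>j' + (i - k) \<le> j + 1 \<le> n\<close>, so the H that occur
      are images of variables.\<close>
    have j': "1 \<le> j'" "j' + i - 1 = j" using 4 by (auto simp: j'_def)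
    have "(- 1) ^ i * E_poly i j = - (\<Sum>k<i. (- 1) ^ k * E_poly k j * H_poly (i - k) j')"
      using sum_E_poly_H_poly_eq_0[of j' i] 4 j'
      by (simp add: lessThan_Suc_atMost[symmetric] H_poly_0 eq_neg_iff_add_eq_0 add.commute)
    then have "(- 1) ^ i * ((- 1) ^ i * E_poly i j) =
        (- 1) ^ i * - (\<Sum>k<i. (- 1) ^ k * E_poly k j * H_poly (i - k) j')" by simp
    then have E: "E_poly i j = (- 1) ^ i * - (\<Sum>k<i. (- 1) ^ k * E_poly k j * H_poly (i - k) j')"
      by (simp add: mult.assoc[symmetric] power_add[symmetric])
    have "lifts n (2 * i) ((- 1) ^ k * E_poly k j * H_poly (i - k) j')" if "k < i" for k
    proof -
      have "2 * i = 0 + 2 * k + 2 * (i - k)" using that by simp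
      then show ?thesis
        using lifts_mult[OF lifts_mult[OF lifts_minus_one_power less.IH[OF that]] lifts_H_poly[of j' "i - k" n], of k]
          4 j' by simp
    qed
    then have "lifts n (0 + 2 * i) ((- 1) ^ i * - (\<Sum>k<i. (- 1) ^ k * E_poly k j * H_poly (i - k) j'))"
      by (intro lifts_mult lifts_minus_one_power lifts_uminus lifts_sum) simp
    then show ?thesis using E by simp
  qed
qed

lemma lifts_coeff_P_poly:
  assumes "j \<le> n" "k \<le> j"
  shows "lifts n (2 * (j - k)) (poly.coeff (P_poly j) k)"
  using lifts_mult[OF lifts_minus_one_power lifts_E_poly[OF assms(1), of "j - k"]] assms(2)
  by (simp add: coeff_P_poly_eq_E_poly)

text \<open>Compare coefficients of t^k in the recurrence. P_a contributes only for
  \<open>a \<ge> k\<close>, and P_k with coefficient 1, so the wanted variable stands alone next to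
  terms with \<open>a > k\<close>; the induction runs downwards from \<open>k = j\<close>.\<close>

lemma lifts_y_poly:
  assumes "k \<le> j" "j < n"
  shows "lifts n (2 * (j + 1 - k)) (y_poly (Suc k) (Suc j))"
  using assms(1)
proof (induction "j - k" arbitrary: k rule: less_induct)
  case less
  let ?c = "case k of 0 \<Rightarrow> 0 | Suc k' \<Rightarrow> poly.coeff (P_poly j) k'"
  have "(\<Sum>a\<le>j. y_poly (Suc a) (Suc j) * poly.coeff (P_poly a) k) =
      (\<Sum>a\<in>insert k {k<..j}. y_poly (Suc a) (Suc j) * poly.coeff (P_poly a) k)"
    using less.prems by (intro sum.mono_neutral_right) (auto simp: coeff_P_poly_eq_0 not_less le_less)
  also have "\<dots> = y_poly (Suc k) (Suc j) + (\<Sum>a\<in>{k<..j}. y_poly (Suc a) (Suc j) * poly.coeff (P_poly a) k)"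
    by (simp add: coeff_P_poly_self)
  finally have y: "y_poly (Suc k) (Suc j) = ?c - poly.coeff (P_poly (Suc j)) k -
      (\<Sum>a\<in>{k<..j}. y_poly (Suc a) (Suc j) * poly.coeff (P_poly a) k)"
    by (simp add: coeff_P_poly_Suc)
  have "lifts n (2 * (j + 1 - k)) ?c"
    using lifts_coeff_P_poly[of j n "k - 1"] less.prems assms(2)
    by (auto simp: lifts_zero split: nat.split)
  moreover have "lifts n (2 * (j + 1 - k)) (poly.coeff (P_poly (Suc j)) k)"
    using lifts_coeff_P_poly[of "Suc j" n k] less.prems assms(2) by simp
  moreover have "lifts n (2 * (j + 1 - k)) (y_poly (Suc a) (Suc j) * poly.coeff (P_poly a) k)"
    if "a \<in> {k<..j}" for a
  proof -
    have "2 * (j + 1 - k) = 2 * (j + 1 - a) + 2 * (a - k)" "j - a < j - k" using that by auto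
    then show ?thesis
      using lifts_mult[OF less.hyps[of a] lifts_coeff_P_poly[of a n k]] that assms(2) by simp
  qed
  ultimately show ?case
    unfolding y by (intro lifts_diff lifts_sum)
qed

lemma lifts_var:
  assumes "v \<in> XQ_vars n"
  shows "lifts n (xq_deg v) (var v)"
proof (cases v)
  case (X i)
  then show ?thesis
    using lifts_y_poly[of "i - 1" "i - 1" n] assms by (auto simp: XQ_vars_def y_poly_def)
next
  case (Q i j)
  then have ij: "1 \<le> i" "i < j" "j \<le> n" using assms by (auto simp: XQ_vars_def)
  have "var v = (- 1) ^ (j - i) * y_poly (Suc (i - 1)) (Suc (j - 1))"
    using Q ij by (simp add: y_poly_def mult.assoc[symmetric] power_add[symmetric])
  moreover have "xq_deg v = 0 + 2 * (j - 1 + 1 - (i - 1))"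
    using Q ij by simp
  moreover have "lifts n (2 * (j - 1 + 1 - (i - 1))) (y_poly (Suc (i - 1)) (Suc (j - 1)))"
    using ij by (intro lifts_y_poly) auto
  ultimately show ?thesis
    using lifts_mult[OF lifts_minus_one_power] by metis
qed

lemma lifts_frag_of:
  assumes "Poly_Mapping.keys m \<subseteq> XQ_vars n"
  shows "lifts n (weighted_deg xq_deg m) (frag_of m)"
  unfolding frag_of_eq_prod_var monom_eval_def weighted_deg_def
  using assms by (intro lifts_prod lifts_power lifts_var) auto

lemma lifts_homogeneous:
  assumes "p \<in> homogeneous_part (XQ_vars n) xq_deg d"
  shows "lifts n d p"
  by (rule frag_induction[of p "{m. Poly_Mapping.keys m \<subseteq> XQ_vars n \<and> weighted_deg xq_deg m = d}"])
    (use assms in \<open>auto simp: homogeneous_part_iff intro: lifts_zero lifts_diff dest: lifts_frag_of\<close>)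

lemma phi_image_ZU_grading: "phi n ` ZU_grading n d = Q_grading n d"
proof
  show "phi n ` ZU_grading n d \<subseteq> Q_grading n d"
    using H_eval_homogeneous by (auto simp: phi_eq Q_grading_def)
  show "Q_grading n d \<subseteq> phi n ` ZU_grading n d"
    using lifts_homogeneous by (auto simp: Q_grading_def lifts_def)
qed

text \<open>A general \<open>p\<close> mixes degrees, so \<open>lifts\<close> is applied to single
  monomials and the degrees are forgotten before adding up.\<close>

lemma to_Q_mem_phi_image:
  assumes "p \<in> carrier (R_ring n)"
  shows "to_Q n p \<in> phi n ` carrier (ZU_ring n)"
proof -
  have "p \<in> carrier (R_ring n) \<and> (\<exists>z \<in> carrier (ZU_ring n). to_Q n p = phi n z)"
  proof (rule frag_induction[of p "{m. Poly_Mapping.keys m \<subseteq> XQ_vars n}"])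
    show "Poly_Mapping.keys p \<subseteq> {m. Poly_Mapping.keys m \<subseteq> XQ_vars n}"
      using assms by (auto simp: R_ring_def carrier_poly_over_iff)
    show "0 \<in> carrier (R_ring n) \<and> (\<exists>z \<in> carrier (ZU_ring n). to_Q n 0 = phi n z)"
      by (rule liftsE[OF lifts_zero[of n 0]]) blast
    show "frag_of m \<in> carrier (R_ring n) \<and> (\<exists>z \<in> carrier (ZU_ring n). to_Q n (frag_of m) = phi n z)"
      if "m \<in> {m. Poly_Mapping.keys m \<subseteq> XQ_vars n}" for m
      by (rule liftsE[OF lifts_frag_of[of m n]]) (use that in blast)+
    fix a b
    assume "a \<in> carrier (R_ring n) \<and> (\<exists>z \<in> carrier (ZU_ring n). to_Q n a = phi n z)"
      and "b \<in> carrier (R_ring n) \<and> (\<exists>z \<in> carrier (ZU_ring n). to_Q n b = phi n z)"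
    then obtain z w where z: "a \<in> carrier (R_ring n)" "z \<in> carrier (ZU_ring n)" "to_Q n a = phi n z"
      and w: "b \<in> carrier (R_ring n)" "w \<in> carrier (ZU_ring n)" "to_Q n b = phi n w" by auto
    have closed: "- b \<in> carrier (R_ring n)" "- w \<in> carrier (ZU_ring n)"
      using z w by (simp_all add: R_ring_def ZU_ring_def poly_over_uminus_closed)
    have "to_Q n (a + - b) = phi n (z + - w)"
      unfolding to_Q_simps(3)[OF z(1) closed(1)] phi_simps(3)[OF z(2) closed(2)]
        to_Q_simps(5)[OF w(1)] phi_simps(5)[OF w(2)] z(3) w(3) ..
    moreover have "a + - b \<in> carrier (R_ring n)" "z + - w \<in> carrier (ZU_ring n)"
      using z w closed poly_over_add_closed unfolding R_ring_def ZU_ring_def by blast+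
    ultimately show "a - b \<in> carrier (R_ring n) \<and> (\<exists>z \<in> carrier (ZU_ring n). to_Q n (a - b) = phi n z)"
      unfolding diff_conv_add_uminus by blast
  qed
  then show ?thesis by blast
qed

lemma phi_iso: "phi n \<in> ring_iso (ZU_ring n) (Q_ring n)"
proof -
  have "carrier (Q_ring n) = to_Q n ` carrier (R_ring n)"
    by (auto simp: Q_ring_def FactRing_def A_RCOSETS_def' to_Q_def)
  then have "carrier (Q_ring n) \<subseteq> phi n ` carrier (ZU_ring n)"
    by (simp add: image_subset_iff to_Q_mem_phi_image)
  then have "phi n ` carrier (ZU_ring n) = carrier (Q_ring n)"
    by (intro equalityI image_subsetI ring_hom_closed[OF phi_hom])
  then show ?thesis
    using inj_on_phi[of n] phi_hom[of n] by (simp add: ring_iso_def bij_betw_def)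
qed

theorem theorem1p1:
  fixes n :: nat
  assumes "n \<ge> 1"
  shows "phi n \<in> ring_hom (ZU_ring n) (Q_ring n) \<and>
    (\<forall>i j. 1 \<le> j \<and> j < i \<and> i \<le> n \<longrightarrow> phi n (var (i, j)) = to_Q n (H_poly (i - j) j)) \<and>
    graded_ring_iso (ZU_ring n) (ZU_grading n) (Q_ring n) (Q_grading n) (phi n)"
proof (intro conjI allI impI)
  show "phi n \<in> ring_hom (ZU_ring n) (Q_ring n)" by (rule phi_hom)
  show "phi n (var (i, j)) = to_Q n (H_poly (i - j) j)" for i j
    by (simp add: phi_eq H_var_def)
  have "graded_ring (ZU_ring n) (ZU_grading n)"
    unfolding ZU_ring_def ZU_grading_def by (rule graded_ring_poly_over)
  moreover from graded_ring_iso_image[OF this ring_Q_ring phi_iso]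
  have "graded_ring (Q_ring n) (Q_grading n)"
    by (simp only: phi_image_ZU_grading)
  ultimately show "graded_ring_iso (ZU_ring n) (ZU_grading n) (Q_ring n) (Q_grading n) (phi n)"
    by (simp add: graded_ring_iso_def phi_iso phi_image_ZU_grading)
qed

end
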